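(* Let $u$ be a positive integer such that the square-free part of $u$ divides $6$. Then there exists a $TA(4u^2-1,\,u^2,\,u^2+u,\,u^2-u,\,u^2:(2u^2-u)\times(2u^2+u))$. Moreover, there exists a $TA(3999,625,2600,150,625:775\times 3225)$.
   Context: A triple array $TA(v,k,\lambda_{rr},\lambda_{cc},\lambda_{rc}:r\times c)$ is an $r\times c$ array (every cell filled) on $v$ symbols such that no symbol occurs more than once in any row or column, and: (TA1) each symbol occurs exactly $k$ times; (TA2) any two distinct rows contain exactly $\lambda_{rr}$ common symbols; (TA3) any two distinct columns contain exactly $\lambda_{cc}$ common symbols; (TA4) any row and any column contain exactly $\lambda_{rc}$ common symbols. The square-free part of a positive integer $u$ is the unique square-free positive integer $s$ such that $u=sm^2$ for some integer $m$. *)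

theory Defs
  imports "HOL-Computational_Algebra.Squarefree"
begin

definition row_symbols :: "nat \<Rightarrow> (nat \<Rightarrow> nat \<Rightarrow> 'a) \<Rightarrow> nat \<Rightarrow> 'a set" where
  "row_symbols c A i = (\<lambda>j. A i j) ` {..<c}"

definition col_symbols :: "nat \<Rightarrow> (nat \<Rightarrow> nat \<Rightarrow> 'a) \<Rightarrow> nat \<Rightarrow> 'a set" where
  "col_symbols r A j = (\<lambda>i. A i j) ` {..<r}"

(* Rows are indexed by {..<r} and columns by {..<c}; values of A outside these ranges are
   irrelevant.  V is the symbol set. *)
definition triple_array ::
  "nat \<Rightarrow> nat \<Rightarrow> nat \<Rightarrow> nat \<Rightarrow> nat \<Rightarrow> nat \<Rightarrow> nat \<Rightarrow> 'a set \<Rightarrow> (nat \<Rightarrow> nat \<Rightarrow> 'a) \<Rightarrow> bool" where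
  "triple_array v k lrr lcc lrc r c V A \<longleftrightarrow>
     finite V \<and> card V = v \<and>
     (\<forall>i<r. \<forall>j<c. A i j \<in> V) \<and>
     (\<forall>i<r. inj_on (\<lambda>j. A i j) {..<c}) \<and>
     (\<forall>j<c. inj_on (\<lambda>i. A i j) {..<r}) \<and>
     (\<forall>x\<in>V. card {(i, j). i < r \<and> j < c \<and> A i j = x} = k) \<and>
     (\<forall>i<r. \<forall>i'<r. i \<noteq> i' \<longrightarrow> card (row_symbols c A i \<inter> row_symbols c A i') = lrr) \<and>
     (\<forall>j<c. \<forall>j'<c. j \<noteq> j' \<longrightarrow> card (col_symbols r A j \<inter> col_symbols r A j') = lcc) \<and>
     (\<forall>i<r. \<forall>j<c. card (row_symbols c A i \<inter> col_symbols r A j) = lrc)"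

(* The library's squarefree_part is the unique squarefree s with u = s * m^2 for some m. *)
lemma squarefree_part_nat_iff:
  fixes u s :: nat
  assumes "u > 0"
  shows "squarefree_part u = s \<longleftrightarrow> squarefree s \<and> (\<exists>m. u = s * m ^ 2)"
proof
  assume "squarefree_part u = s"
  then show "squarefree s \<and> (\<exists>m. u = s * m ^ 2)"
    using squarefree_decompose[of u] squarefree_squarefree_part[of u] by blast
next
  assume "squarefree s \<and> (\<exists>m. u = s * m ^ 2)"
  then obtain m where s: "squarefree s" and u: "u = s * m ^ 2" by blast
  have nz: "s \<noteq> 0" "m \<noteq> 0" using assms u by auto
  show "squarefree_part u = s"
  proof (rule multiplicity_eq_nat)
    fix p :: nat assume p: "prime p"
    have "multiplicity p u = multiplicity p s + 2 * multiplicity p m"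
      using p nz by (simp add: u prime_elem_multiplicity_mult_distrib
                               prime_elem_multiplicity_power_distrib)
    moreover have "multiplicity p s \<le> 1"
      using s nz p squarefree_factorial_semiring''[of s] by auto
    ultimately show "multiplicity p (squarefree_part u) = multiplicity p s"
      using p by (simp add: prime_multiplicity_squarefree_part)
  qed (use nz in \<open>auto intro: Nat.gr0I\<close>)
qed

end

theory Submission
  imports Defs "HOL-Library.Z2" "HOL-Library.Product_Plus" "HOL-Library.Function_Algebras"
    "HOL-Number_Theory.Euler_Criterion"
begin

text \<open>
  If \<open>D = - D\<close> is a difference set in a finite abelian group, then the array of differences \<open>x - y\<close>, with rows
  \<open>x \<in> D\<close> and columns \<open>y \<notin> D\<close>, is a triple array on the nonzero elements: all four conditions reduce to the
  difference property, the row-column condition because \<open>- D = D\<close>. McFarland's difference set in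
  \<open>\<int>\<^sub>5\<^sup>3 \<times> \<int>\<^sub>2\<^sup>5\<close> is of this kind and gives the second array.

  For the first family, an even \<open>\<pm>1\<close> function on a group of order \<open>4 u\<^sup>2\<close> with zero autocorrelation is needed. Tensor
  products turn \<open>u, v\<close> into \<open>2 u v\<close>, which takes care of the factors 2. Without the factor 2, quadruples of
  even \<open>\<pm>1\<close> functions on a group of order \<open>u\<^sup>2\<close> are multiplicative by Turyn's composition, so it suffices to
  treat \<open>u = 3\<close>, where four lines of \<open>\<int>\<^sub>3\<^sup>2\<close> work, and \<open>u = p\<^sup>2\<close> for odd primes \<open>p\<close>. In the latter case let \<open>K\<close> be the
  field of order \<open>p\<^sup>2\<close>, with quadratic character \<open>\<eta>\<close>. The Paley conference matrix \<open>M\<close> on the projective line over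
  \<open>K\<close> has two \<open>\<pm>1\<close> eigenvectors \<open>h\<^sub>1, h\<^sub>2\<close> with eigenvalues \<open>p\<close> and \<open>- p\<close>, each constant on the lines of one parallel
  class of the affine plane \<open>K = (\<int>\<^sub>p)\<^sup>2\<close>. Then \<open>s = (h\<^sub>1 + h\<^sub>2) / 2\<close> and \<open>t = (h\<^sub>1 - h\<^sub>2) / 2\<close> have complementary supports
  of odd size and \<open>M s = p t\<close>, \<open>M t = p s\<close>. Spreading \<open>s\<close> and \<open>t\<close> over the lines of \<open>K\<^sup>2\<close> with the character \<open>\<eta>\<close>,
  and combining them with signed sums of lines from the two supports, gives the four functions.
\<close>

section \<open>Triple arrays from difference sets\<close>

text \<open>Groups are finite subsets of an ambient group type instead of types: the orders needed
  are unbounded, and sets let one fixed type hold all the groups.\<close>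

definition subgrp :: "'a::ab_group_add set \<Rightarrow> bool" where
  "subgrp H \<longleftrightarrow> finite H \<and> 0 \<in> H \<and> (\<forall>x\<in>H. \<forall>y\<in>H. x - y \<in> H)"

lemma subgrp_finite: "subgrp H \<Longrightarrow> finite H"
  and subgrp_zero: "subgrp H \<Longrightarrow> 0 \<in> H"
  and subgrp_diff: "subgrp H \<Longrightarrow> x \<in> H \<Longrightarrow> y \<in> H \<Longrightarrow> x - y \<in> H"
  by (auto simp: subgrp_def)

lemma subgrp_minus: "subgrp H \<Longrightarrow> x \<in> H \<Longrightarrow> - x \<in> H"
  using subgrp_diff[of H 0 x] subgrp_zero by auto

lemma subgrp_add: "subgrp H \<Longrightarrow> x \<in> H \<Longrightarrow> y \<in> H \<Longrightarrow> x + y \<in> H"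
  using subgrp_diff[of H x "- y"] subgrp_minus by auto

lemmas subgrp_simps = subgrp_finite subgrp_zero subgrp_diff subgrp_minus subgrp_add

lemma card_reflect_subgrp:
  assumes "subgrp G" "x \<in> G"
  shows "card {z\<in>G. P (x - z)} = card {w\<in>G. P w}"
  by (rule bij_betw_same_card[of "\<lambda>z. x - z"], rule bij_betw_byWitness[of _ "\<lambda>z. x - z"])
     (use assms in \<open>auto simp: subgrp_simps\<close>)

lemma card_shift_subgrp:
  assumes "subgrp G" "x \<in> G"
  shows "card {z\<in>G. P (z + x)} = card {w\<in>G. P w}"
  by (rule bij_betw_same_card[of "\<lambda>z. z + x"], rule bij_betw_byWitness[of _ "\<lambda>z. z - x"])
     (use assms in \<open>auto simp: subgrp_simps\<close>)

text \<open>As group elements, row \<open>x\<close> shows the \<open>z\<close> with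
  \<open>x - z \<notin> D\<close> and column \<open>y\<close> the \<open>z\<close> with
  \<open>z + y \<in> D\<close>. Two columns thus share an intersection of two translates of
  \<open>D\<close>, of size \<open>l\<close>. Two rows share the complement of a union of two
  reflected translates, of size \<open>v - (2 * k - l)\<close>. A row and a column share a translate
  of \<open>D\<close> with another translate removed, of size \<open>k - l\<close>.\<close>

theorem triple_array_of_difference_set:
  fixes G D :: "'a::ab_group_add set"
  assumes G: "subgrp G" and cG: "card G = v" and DG: "D \<subseteq> G" and cD: "card D = k"
    and rev: "\<And>x. x \<in> D \<Longrightarrow> - x \<in> D"
    and dif: "\<And>x. x \<in> G \<Longrightarrow> x \<noteq> 0 \<Longrightarrow> card {y\<in>D. y - x \<in> D} = l"
  shows "\<exists>(V :: nat set) A. triple_array (v - 1) (k - l) (v + l - 2 * k) l (k - l) k (v - k) V A"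
proof -
  have fG: "finite G" and fD: "finite D" using G DG finite_subset subgrp_finite by blast+
  obtain d where d: "bij_betw d {..<k} D"
    using ex_bij_betw_nat_finite[OF fD] cD atLeast0LessThan by metis
  obtain e where e: "bij_betw e {..<v - k} (G - D)"
    using ex_bij_betw_nat_finite[of "G - D"] fG cG cD card_Diff_subset[OF fD DG] atLeast0LessThan
    by (metis finite_Diff)
  obtain s where s: "bij_betw s (G - {0}) {..<v - 1}"
    using ex_bij_betw_finite_nat[of "G - {0}"] fG cG G
    by (metis atLeast0LessThan card_Diff_singleton finite_Diff subgrp_zero)
  have sinj: "inj_on s (G - {0})" and sim: "s ` (G - {0}) = {..<v - 1}"
    using s by (auto simp: bij_betw_def)
  define A where "A i j = s (d i - e j)" for i j
  have dD: "d i \<in> D" if "i < k" for i using d that by (auto simp: bij_betw_def)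
  have eD: "e j \<in> G - D" if "j < v - k" for j
    using e that by (metis bij_betwE lessThan_iff)
  have dinj: "d i = d i' \<longleftrightarrow> i = i'" if "i < k" "i' < k" for i i'
    using d that by (auto simp: bij_betw_def inj_on_def)
  have einj: "e i = e i' \<longleftrightarrow> i = i'" if "i < v - k" "i' < v - k" for i i'
    using e that by (auto simp: bij_betw_def inj_on_def)
  have mem: "x - y \<in> G - {0}" if "x \<in> D" "y \<in> G - D" for x y
    using that DG G by (auto simp: subgrp_simps)
  have Aeq: "A i j = A i' j' \<longleftrightarrow> d i - e j = d i' - e j'"
    if "i < k" "i' < k" "j < v - k" "j' < v - k" for i i' j j'
    unfolding A_def
    by (rule inj_on_eq_iff[OF sinj mem[OF dD[OF that(1)] eD[OF that(3)]] mem[OF dD[OF that(2)] eD[OF that(4)]]])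
  define R where "R x = {z\<in>G. x - z \<notin> D}" for x
  define C where "C y = {z\<in>G. z + y \<in> D}" for y
  have R0: "R x \<subseteq> G - {0}" if "x \<in> D" for x using that by (auto simp: R_def)
  have C0: "C y \<subseteq> G - {0}" if "y \<in> G - D" for y using that by (auto simp: C_def)
  have row: "row_symbols (v - k) A i = s ` R (d i)" if "i < k" for i
  proof -
    have "row_symbols (v - k) A i = s ` ((\<lambda>y. d i - y) ` (e ` {..<v - k}))"
      by (auto simp: row_symbols_def A_def image_image)
    also have "e ` {..<v - k} = G - D" using e by (auto simp: bij_betw_def)
    also have "(\<lambda>y. d i - y) ` (G - D) = R (d i)"
    proof (intro equalityI subsetI)
      fix z assume "z \<in> R (d i)"
      then have "d i - z \<in> G - D" "z = d i - (d i - z)"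
        using G DG dD[OF that] by (auto simp: R_def subgrp_simps)
      then show "z \<in> (\<lambda>y. d i - y) ` (G - D)" by blast
    qed (use G DG dD[OF that] in \<open>auto simp: R_def subgrp_simps\<close>)
    finally show ?thesis .
  qed
  have col: "col_symbols k A j = s ` C (e j)" if "j < v - k" for j
  proof -
    have "col_symbols k A j = s ` ((\<lambda>x. x - e j) ` (d ` {..<k}))"
      by (auto simp: col_symbols_def A_def image_image)
    also have "d ` {..<k} = D" using d by (auto simp: bij_betw_def)
    also have "(\<lambda>x. x - e j) ` D = C (e j)"
    proof (intro equalityI subsetI)
      fix z assume "z \<in> C (e j)"
      then have "z + e j \<in> D" "z = (z + e j) - e j"
        by (auto simp: C_def)
      then show "z \<in> (\<lambda>x. x - e j) ` D" by blast
    qed (use G DG eD[OF that] in \<open>auto simp: C_def subgrp_simps\<close>)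
    finally show ?thesis .
  qed
  have card_int: "card (s ` X \<inter> s ` Y) = card (X \<inter> Y)" if "X \<subseteq> G - {0}" "Y \<subseteq> G - {0}" for X Y
    using inj_on_image_Int[OF sinj that] card_image[OF inj_on_subset[OF sinj, of "X \<inter> Y"]] that
    by (metis Int_lower1 order_trans)
  have l_le: "card {y\<in>D. y - x \<notin> D} = k - l" if "x \<in> G" "x \<noteq> 0" for x
  proof -
    have "{y\<in>D. y - x \<notin> D} = D - {y\<in>D. y - x \<in> D}" by auto
    then show ?thesis using dif[OF that] cD fD by (simp add: card_Diff_subset)
  qed
  have RR: "card (R x \<inter> R x') = v + l - 2 * k" if "x \<in> D" "x' \<in> D" "x \<noteq> x'" for x x'
  proof -
    have xG: "x \<in> G" "x' \<in> G" "x - x' \<in> G" using that DG by (auto intro!: subgrp_diff G)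
    define P where "P = {z\<in>G. x - z \<in> D}"
    define Q where "Q = {z\<in>G. x' - z \<in> D}"
    have GD: "{w\<in>G. w \<in> D} = D" using DG by auto
    have cP: "card P = k" "card Q = k"
      using card_reflect_subgrp[OF G xG(1), of "\<lambda>w. w \<in> D"]
        card_reflect_subgrp[OF G xG(2), of "\<lambda>w. w \<in> D"] cD GD by (simp_all add: P_def Q_def)
    have PQ: "card (P \<inter> Q) = l"
    proof -
      have "P \<inter> Q = {z\<in>G. x - z \<in> D \<and> (x - z) - (x - x') \<in> D}"
        by (auto simp: P_def Q_def)
      also have "card \<dots> = card {w\<in>G. w \<in> D \<and> w - (x - x') \<in> D}"
        by (rule card_reflect_subgrp[OF G xG(1), of "\<lambda>w. w \<in> D \<and> w - (x - x') \<in> D"])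
      also have "{w\<in>G. w \<in> D \<and> w - (x - x') \<in> D} = {w\<in>D. w - (x - x') \<in> D}" using DG by auto
      finally show ?thesis using dif[OF xG(3)] that by simp
    qed
    have f: "finite P" "finite Q" "P \<subseteq> G" "Q \<subseteq> G" using fG by (auto simp: P_def Q_def)
    have c: "card (P \<union> Q) + l = 2 * k" using card_Un_Int[of P Q] f cP PQ by simp
    have "R x \<inter> R x' = G - (P \<union> Q)" by (auto simp: R_def P_def Q_def)
    moreover have "card (G - (P \<union> Q)) = v - card (P \<union> Q)"
      using f fG cG by (simp add: card_Diff_subset)
    ultimately have "card (R x \<inter> R x') = v - card (P \<union> Q)" by simp
    then show ?thesis using c by linarith
  qed
  have CC: "card (C y \<inter> C y') = l" if "y \<in> G" "y' \<in> G" "y \<noteq> y'" for y y'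
  proof -
    have yG: "y - y' \<in> G" using that G by (auto simp: subgrp_simps)
    have "C y \<inter> C y' = {z\<in>G. z + y \<in> D \<and> (z + y) - (y - y') \<in> D}" by (auto simp: C_def)
    also have "card \<dots> = card {w\<in>G. w \<in> D \<and> w - (y - y') \<in> D}"
      by (rule card_shift_subgrp[OF G that(1), of "\<lambda>w. w \<in> D \<and> w - (y - y') \<in> D"])
    also have "{w\<in>G. w \<in> D \<and> w - (y - y') \<in> D} = {w\<in>D. w - (y - y') \<in> D}" using DG by auto
    finally show ?thesis using dif[OF yG] that by simp
  qed
  have RC: "card (R x \<inter> C y) = k - l" if "x \<in> D" "y \<in> G - D" for x y
  proof -
    have yG: "y \<in> G" "x + y \<in> G" using that DG by (auto intro!: subgrp_add G)
    \<comment> \<open>The symmetry of \<open>D\<close> enters twice: it keeps \<open>x + y\<close>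
      away from 0, and it lets \<open>x - z\<close>, the negative of
      \<open>(z + y) - (x + y)\<close>, be tested for membership in \<open>D\<close> with either
      sign.\<close>
    have ne: "x + y \<noteq> 0" 
    proof
      assume "x + y = 0"
      then have "y = - x" by (simp add: eq_neg_iff_add_eq_0 add.commute)
      then show False using that rev[of x] by auto
    qed
    have rv: "- z \<in> D \<longleftrightarrow> z \<in> D" for z using rev[of z] rev[of "- z"] by auto
    have "R x \<inter> C y = {z\<in>G. z + y \<in> D \<and> - ((z + y) - (x + y)) \<notin> D}" by (auto simp: R_def C_def)
    also have "\<dots> = {z\<in>G. z + y \<in> D \<and> (z + y) - (x + y) \<notin> D}" unfolding rv ..
    also have "card \<dots> = card {w\<in>G. w \<in> D \<and> w - (x + y) \<notin> D}"
      by (rule card_shift_subgrp[OF G yG(1), of "\<lambda>w. w \<in> D \<and> w - (x + y) \<notin> D"])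
    also have "{w\<in>G. w \<in> D \<and> w - (x + y) \<notin> D} = {w\<in>D. w - (x + y) \<notin> D}" using DG by auto
    finally show ?thesis using l_le[OF yG(2) ne] by simp
  qed
  have occ: "card {(i, j). i < k \<and> j < v - k \<and> A i j = n} = k - l" if n: "n < v - 1" for n
  proof -
    obtain z where z: "z \<in> G" "z \<noteq> 0" "n = s z" using n sim by blast
    have eqz: "A i j = n \<longleftrightarrow> d i - e j = z" if "i < k" "j < v - k" for i j
      unfolding A_def z(3) using inj_on_eq_iff[OF sinj mem[OF dD[OF that(1)] eD[OF that(2)]], of z] z by simp
    \<comment> \<open>The symbol \<open>z\<close> in row \<open>x\<close> can only stand in column
      \<open>x - z\<close>, so an occurrence is determined by its row; the condition left is that
      \<open>x - z\<close> lies outside \<open>D\<close>.\<close>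
    have "bij_betw (\<lambda>(i, j). d i) {(i, j). i < k \<and> j < v - k \<and> A i j = n} {x\<in>D. x - z \<notin> D}"
      unfolding bij_betw_def
    proof
      show "inj_on (\<lambda>(i, j). d i) {(i, j). i < k \<and> j < v - k \<and> A i j = n}"
      proof (rule inj_onI, clarify)
        fix i j i' j' assume *: "i < k" "j < v - k" "i' < k" "j' < v - k" "d i = d i'"
          "n = A i j" "A i' j' = A i j"
        have "d i - e j = z" "d i' - e j' = z" using eqz[OF *(1,2)] eqz[OF *(3,4)] *(6,7) by simp_all
        then have "e j = e j'" using *(5) by (metis diff_left_imp_eq)
        then show "i = i' \<and> j = j'" using einj[OF *(2,4)] dinj[OF *(1,3)] *(5) by simp
      qed
      show "(\<lambda>(i, j). d i) ` {(i, j). i < k \<and> j < v - k \<and> A i j = n} = {x\<in>D. x - z \<notin> D}"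
      proof (intro equalityI subsetI)
        fix x assume x: "x \<in> {x\<in>D. x - z \<notin> D}"
        then have xD: "x \<in> D" "x - z \<in> G - D" using subgrp_diff[OF G _ z(1)] DG by auto
        have "e ` {..<v - k} = G - D" "d ` {..<k} = D"
          using d e by (simp_all add: bij_betw_def)
        then have "x \<in> d ` {..<k}" "x - z \<in> e ` {..<v - k}" using xD by simp_all
        then obtain i j where ij: "i < k" "j < v - k" "x - z = e j" "x = d i" by (elim imageE) simp
        have "z = x - (x - z)" by simp
        also have "\<dots> = d i - e j" by (simp only: ij(3) ij(4)[symmetric])
        finally have "A i j = n" using eqz[OF ij(1,2)] by simp
        then show "x \<in> (\<lambda>(i, j). d i) ` {(i, j). i < k \<and> j < v - k \<and> A i j = n}"
          using ij(1,2,4) by force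
      next
        fix x assume "x \<in> (\<lambda>(i, j). d i) ` {(i, j). i < k \<and> j < v - k \<and> A i j = n}"
        then obtain i j where ij: "i < k" "j < v - k" "A i j = n" "x = d i" by auto
        have "z = d i - e j" using eqz[OF ij(1,2)] ij(3) by simp
        then have "x - z = e j" unfolding ij(4) by simp
        then show "x \<in> {x\<in>D. x - z \<notin> D}" using ij(4) dD[OF ij(1)] eD[OF ij(2)] by simp
      qed
    qed
    from bij_betw_same_card[OF this] show ?thesis using l_le[OF z(1,2)] by simp
  qed
  have "triple_array (v - 1) (k - l) (v + l - 2 * k) l (k - l) k (v - k) {..<v - 1} A"
    unfolding triple_array_def
  proof (intro conjI allI impI ballI)
    fix i j assume "i < k" "j < v - k"
    then show "A i j \<in> {..<v - 1}" unfolding A_def using mem[OF dD eD] sim by blast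
  next
    fix i assume i: "i < k"
    show "inj_on (A i) {..<v - k}"
    proof (rule inj_onI)
      fix j j' assume "j \<in> {..<v - k}" "j' \<in> {..<v - k}" "A i j = A i j'"
      then show "j = j'" using Aeq[OF i i, of j j'] einj[of j j'] by simp
    qed
  next
    fix j assume j: "j < v - k"
    show "inj_on (\<lambda>i. A i j) {..<k}"
    proof (rule inj_onI)
      fix i i' assume "i \<in> {..<k}" "i' \<in> {..<k}" "A i j = A i' j"
      then show "i = i'" using Aeq[OF _ _ j j, of i i'] dinj[of i i'] by simp
    qed
  next
    fix i i' assume "i < k" "i' < k" "i \<noteq> i'"
    then show "card (row_symbols (v - k) A i \<inter> row_symbols (v - k) A i') = v + l - 2 * k"
      by (simp add: row card_int R0 dD RR dinj)
  next
    fix j j' assume j: "j < v - k" "j' < v - k" "j \<noteq> j'"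
    then show "card (col_symbols k A j \<inter> col_symbols k A j') = l"
      using eD[of j] eD[of j'] by (simp add: col card_int C0 CC einj)
  next
    fix i j assume "i < k" "j < v - k"
    then show "card (row_symbols (v - k) A i \<inter> col_symbols k A j) = k - l"
      using eD[of j] by (simp add: row col card_int C0 R0 dD RC)
  next
    fix n assume "n \<in> {..<v - 1}"
    then show "card {(i, j). i < k \<and> j < v - k \<and> A i j = n} = k - l" using occ by blast
  qed simp_all
  then show ?thesis by blast
qed

section \<open>Turyn and Hadamard groups\<close>

definition conv :: "'a::ab_group_add set \<Rightarrow> ('a \<Rightarrow> real) \<Rightarrow> ('a \<Rightarrow> real) \<Rightarrow> 'a \<Rightarrow> real" where
  "conv H f g x = (\<Sum>y\<in>H. f y * g (x - y))"

lemma conv_commute: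
  assumes "subgrp H" "x \<in> H"
  shows "conv H f g x = conv H g f x"
  unfolding conv_def
  by (rule sum.reindex_bij_witness[of _ "\<lambda>y. x - y" "\<lambda>y. x - y"])
     (use assms in \<open>auto simp: subgrp_simps\<close>)

lemma conv_add_left: "conv H (\<lambda>x. f x + g x) h x = conv H f h x + conv H g h x"
  and conv_add_right: "conv H h (\<lambda>x. f x + g x) x = conv H h f x + conv H h g x"
  and conv_diff_left: "conv H (\<lambda>x. f x - g x) h x = conv H f h x - conv H g h x"
  and conv_diff_right: "conv H h (\<lambda>x. f x - g x) x = conv H h f x - conv H h g x"
  and conv_divide_left: "conv H (\<lambda>x. f x / c) h x = conv H f h x / c"
  and conv_divide_right: "conv H h (\<lambda>x. f x / c) x = conv H h f x / c"
  and conv_scale_left: "conv H (\<lambda>x. c * f x) h x = c * conv H f h x"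
  and conv_scale_right: "conv H h (\<lambda>x. c * f x) x = c * conv H h f x"
  and conv_minus_left: "conv H (\<lambda>x. - f x) h x = - conv H f h x"
  and conv_minus_right: "conv H h (\<lambda>x. - f x) x = - conv H h f x"
  by (simp_all add: conv_def algebra_simps sum.distrib sum_subtractf sum_divide_distrib
      sum_distrib_left sum_negf)

lemmas conv_linear = conv_add_left conv_add_right conv_diff_left conv_diff_right
  conv_divide_left conv_divide_right conv_minus_left conv_minus_right

lemma conv_sum_left: "conv H (\<lambda>x. \<Sum>i\<in>I. f i x) h x = (\<Sum>i\<in>I. conv H (f i) h x)"
  unfolding conv_def sum_distrib_right by (rule sum.swap)

lemma conv_sum_right: "conv H h (\<lambda>x. \<Sum>i\<in>I. f i x) x = (\<Sum>i\<in>I. conv H h (f i) x)"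
  unfolding conv_def sum_distrib_left by (rule sum.swap)

lemma conv_prod:
  "conv (A \<times> B) (\<lambda>z. f (fst z) * g (snd z)) (\<lambda>z. f' (fst z) * g' (snd z)) z
   = conv A f f' (fst z) * conv B g g' (snd z)"
  unfolding conv_def sum_product sum.cartesian_product
  by (intro sum.cong) (auto simp: mult_ac)

lemma conv_image:
  assumes "inj_on \<phi> H" "\<And>x y. \<phi> (x - y) = \<phi> x - \<phi> y" "subgrp H" "x \<in> H"
  shows "conv (\<phi> ` H) (f \<circ> inv_into H \<phi>) (g \<circ> inv_into H \<phi>) (\<phi> x) = conv H f g x"
proof -
  have "conv (\<phi> ` H) (f \<circ> inv_into H \<phi>) (g \<circ> inv_into H \<phi>) (\<phi> x) =
    (\<Sum>y\<in>H. f (inv_into H \<phi> (\<phi> y)) * g (inv_into H \<phi> (\<phi> (x - y))))"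
    unfolding conv_def by (simp add: sum.reindex[OF assms(1)] assms(2))
  also have "\<dots> = conv H f g x"
    unfolding conv_def
    by (intro sum.cong refl) (simp add: inv_into_f_f[OF assms(1)] subgrp_diff assms(3,4) del: assms(2))
  finally show ?thesis .
qed

text \<open>The trivial character is multiplicative on the group ring. This will fix the sum of a
  sign function, hence the size of its difference set, up to a sign.\<close>

lemma sum_conv:
  assumes "subgrp H"
  shows "(\<Sum>x\<in>H. conv H f g x) = sum f H * sum g H"
proof -
  have "(\<Sum>x\<in>H. conv H f g x) = (\<Sum>y\<in>H. f y * (\<Sum>x\<in>H. g (x - y)))"
    unfolding conv_def sum_distrib_left by (rule sum.swap)
  also have "\<dots> = (\<Sum>y\<in>H. f y * sum g H)"
  proof (rule sum.cong[OF refl])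
    fix y assume "y \<in> H"
    then have "(\<Sum>x\<in>H. g (x - y)) = sum g H"
      by (intro sum.reindex_bij_witness[of _ "\<lambda>x. x + y" "\<lambda>x. x - y"])
         (use assms in \<open>auto simp: subgrp_simps\<close>)
    then show "f y * (\<Sum>x\<in>H. g (x - y)) = f y * sum g H" by simp
  qed
  finally show ?thesis by (simp add: sum_distrib_right)
qed

lemma subgrp_prod: "subgrp A \<Longrightarrow> subgrp B \<Longrightarrow> subgrp (A \<times> B)"
  by (auto simp: subgrp_def zero_prod_def)

lemma subgrp_image:
  assumes "\<And>x y. \<phi> (x - y) = \<phi> x - \<phi> y" "subgrp H"
  shows "subgrp (\<phi> ` H)"
proof -
  have "\<phi> 0 = 0" using assms(1)[of 0 0] by simp
  then have "0 \<in> \<phi> ` H" using assms(2) subgrp_zero by (metis image_eqI)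
  then show ?thesis using assms by (auto simp: subgrp_def simp flip: assms(1))
qed

text \<open>Evenness turns autocorrelation into self-convolution, and it gives the set of points
  with value -1 the symmetry \<open>- D = D\<close>.\<close>

definition even_sign :: "'a::ab_group_add set \<Rightarrow> ('a \<Rightarrow> real) \<Rightarrow> bool" where
  "even_sign H f \<longleftrightarrow> (\<forall>x\<in>H. (f x = 1 \<or> f x = -1) \<and> f (- x) = f x)"

lemma even_sign_image:
  assumes "inj_on \<phi> H" "\<And>x y. \<phi> (x - y) = \<phi> x - \<phi> y" "subgrp H" "even_sign H f"
  shows "even_sign (\<phi> ` H) (f \<circ> inv_into H \<phi>)"
proof -
  have "- \<phi> x = \<phi> (- x)" for x using assms(2)[of 0 0] assms(2)[of 0 x] by simp
  then show ?thesis using assms by (auto simp: even_sign_def subgrp_simps)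
qed

text \<open>The four relations are the components of a single equation: the function on the product
  of the Klein four-group with \<open>H\<close> that has \<open>f0, f1, f2, f3\<close> on its four
  cosets squares to \<open>4 * u\<^sup>2\<close> times the unit of the group ring.\<close>

definition turyn_group :: "'a::ab_group_add set \<Rightarrow> nat \<Rightarrow> bool" where
  "turyn_group H u \<longleftrightarrow> subgrp H \<and> card H = u\<^sup>2 \<and>
    (\<exists>f0 f1 f2 f3. even_sign H f0 \<and> even_sign H f1 \<and> even_sign H f2 \<and> even_sign H f3 \<and>
      (\<forall>x\<in>H. conv H f0 f0 x + conv H f1 f1 x + conv H f2 f2 x + conv H f3 f3 x
                = (if x = 0 then 4 * real (u\<^sup>2) else 0) \<and>
              conv H f0 f1 x + conv H f2 f3 x = 0 \<and>
              conv H f0 f2 x + conv H f1 f3 x = 0 \<and>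
              conv H f0 f3 x + conv H f1 f2 x = 0))"

text \<open>The sign function of a Menon-Hadamard difference set that is closed under
  negation.\<close>

definition hadamard_group :: "'a::ab_group_add set \<Rightarrow> nat \<Rightarrow> bool" where
  "hadamard_group H u \<longleftrightarrow> subgrp H \<and> card H = 4 * u\<^sup>2 \<and>
    (\<exists>h. even_sign H h \<and> (\<forall>x\<in>H. conv H h h x = (if x = 0 then 4 * real (u\<^sup>2) else 0)))"

lemma additive_image_zero_iff:
  fixes \<phi> :: "'a::ab_group_add \<Rightarrow> 'b::ab_group_add"
  assumes "inj_on \<phi> H" "\<And>x y. \<phi> (x - y) = \<phi> x - \<phi> y" "subgrp H" "x \<in> H"
  shows "\<phi> x = 0 \<longleftrightarrow> x = 0"
proof -
  have "\<phi> 0 = 0" using assms(2)[of 0 0] by simp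
  then show ?thesis using inj_onD[OF assms(1) _ assms(4) subgrp_zero[OF assms(3)]] by auto
qed

lemma turyn_group_image:
  assumes "inj_on \<phi> H" "\<And>x y. \<phi> (x - y) = \<phi> x - \<phi> y" "turyn_group H u"
  shows "turyn_group (\<phi> ` H) u"
proof -
  have H: "subgrp H" "card (\<phi> ` H) = u\<^sup>2"
    using assms by (auto simp: turyn_group_def card_image)
  note E = even_sign_image[OF assms(1,2) H(1)]
  note C = conv_image[OF assms(1,2) H(1)]
  note Z = additive_image_zero_iff[OF assms(1,2) H(1)]
  obtain f0 f1 f2 f3 where f: "even_sign H f0" "even_sign H f1" "even_sign H f2" "even_sign H f3"
    "\<forall>x\<in>H. conv H f0 f0 x + conv H f1 f1 x + conv H f2 f2 x + conv H f3 f3 x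
                = (if x = 0 then 4 * real (u\<^sup>2) else 0) \<and>
              conv H f0 f1 x + conv H f2 f3 x = 0 \<and>
              conv H f0 f2 x + conv H f1 f3 x = 0 \<and>
              conv H f0 f3 x + conv H f1 f2 x = 0"
    using assms(3) unfolding turyn_group_def by blast
  show ?thesis unfolding turyn_group_def
    apply (intro conjI subgrp_image assms(2) H)
    apply (rule exI[of _ "f0 \<circ> inv_into H \<phi>"], rule exI[of _ "f1 \<circ> inv_into H \<phi>"],
        rule exI[of _ "f2 \<circ> inv_into H \<phi>"], rule exI[of _ "f3 \<circ> inv_into H \<phi>"])
    using f by (simp add: E C Z)
qed

lemma hadamard_group_image:
  assumes "inj_on \<phi> H" "\<And>x y. \<phi> (x - y) = \<phi> x - \<phi> y" "hadamard_group H u"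
  shows "hadamard_group (\<phi> ` H) u"
proof -
  have H: "subgrp H" "card (\<phi> ` H) = 4 * u\<^sup>2"
    using assms by (auto simp: hadamard_group_def card_image)
  obtain h where h: "even_sign H h"
    "\<forall>x\<in>H. conv H h h x = (if x = 0 then 4 * real (u\<^sup>2) else 0)"
    using assms(3) unfolding hadamard_group_def by blast
  show ?thesis unfolding hadamard_group_def
    apply (intro conjI subgrp_image assms(2) H)
    apply (rule exI[of _ "h \<circ> inv_into H \<phi>"])
    using h even_sign_image[OF assms(1,2) H(1)] conv_image[OF assms(1,2) H(1)]
       additive_image_zero_iff[OF assms(1,2) H(1)] by simp
qed

text \<open>The square of a tensor product is the tensor product of the squares. The orders multiply
  to \<open>4 * (2 * u * w)\<^sup>2\<close>, whence the factor 2.\<close>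

lemma hadamard_group_prod:
  assumes "hadamard_group A u" "hadamard_group B w"
  shows "hadamard_group (A \<times> B) (2 * u * w)"
proof -
  obtain g where g: "even_sign A g" "\<forall>x\<in>A. conv A g g x = (if x = 0 then 4 * real (u\<^sup>2) else 0)"
    using assms(1) unfolding hadamard_group_def by blast
  obtain h where h: "even_sign B h" "\<forall>x\<in>B. conv B h h x = (if x = 0 then 4 * real (w\<^sup>2) else 0)"
    using assms(2) unfolding hadamard_group_def by blast
  have "subgrp (A \<times> B)" "card (A \<times> B) = 4 * (2 * u * w)\<^sup>2"
    using assms by (simp_all add: hadamard_group_def subgrp_prod card_cartesian_product
      power_mult_distrib)
  moreover have "even_sign (A \<times> B) (\<lambda>z. g (fst z) * h (snd z))"
    using g(1) h(1) by (fastforce simp: even_sign_def)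
  moreover have "conv (A \<times> B) (\<lambda>z. g (fst z) * h (snd z)) (\<lambda>z. g (fst z) * h (snd z)) z =
      (if z = 0 then 4 * real ((2 * u * w)\<^sup>2) else 0)" if "z \<in> A \<times> B" for z
    unfolding conv_prod using g(2) h(2) that by (auto simp: power_mult_distrib zero_prod_def prod_eq_iff)
  ultimately show ?thesis unfolding hadamard_group_def by blast
qed

text \<open>Of the half sum and the half difference of two signs exactly one is nonzero, and that
  one is a sign; so exactly one of \<open>k\<close>, \<open>l\<close> survives at each
  point.\<close>

lemma even_sign_half_sum_diff:
  assumes "even_sign A f" "even_sign A f'" "even_sign B k" "even_sign B l"
  shows "even_sign (A \<times> B)
    (\<lambda>t. (f (fst t) + f' (fst t)) / 2 * k (snd t) + (f (fst t) - f' (fst t)) / 2 * l (snd t))"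
  unfolding even_sign_def
proof
  fix t assume "t \<in> A \<times> B"
  then obtain a b where t: "t = (a, b)" "a \<in> A" "b \<in> B" by auto
  have "f a = 1 \<or> f a = -1" "f' a = 1 \<or> f' a = -1" "k b = 1 \<or> k b = -1" "l b = 1 \<or> l b = -1"
    "f (- a) = f a" "f' (- a) = f' a" "k (- b) = k b" "l (- b) = l b"
    using assms t(2,3) by (simp_all add: even_sign_def)
  then show "((f (fst t) + f' (fst t)) / 2 * k (snd t) + (f (fst t) - f' (fst t)) / 2 * l (snd t) = 1 \<or>
     (f (fst t) + f' (fst t)) / 2 * k (snd t) + (f (fst t) - f' (fst t)) / 2 * l (snd t) = -1) \<and>
     (f (fst (- t)) + f' (fst (- t))) / 2 * k (snd (- t)) + (f (fst (- t)) - f' (fst (- t))) / 2 * l (snd (- t)) =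
     (f (fst t) + f' (fst t)) / 2 * k (snd t) + (f (fst t) - f' (fst t)) / 2 * l (snd t)"
    unfolding t(1) by (elim disjE) simp_all
qed

text \<open>Turyn's composition: \<open>w, x\<close> have disjoint supports covering \<open>A\<close>, likewise \<open>y, z\<close>, so the four
  functions below are again \<open>\<pm>1\<close>-valued; the relations on the \<open>f i\<close> say exactly that
  \<open>w * y = x * z = 0\<close> and \<open>w * w + y * y = x * x + z * z = u\<^sup>2\<close> under convolution.\<close>
lemma turyn_group_prod:
  fixes A :: "'a::ab_group_add set" and B :: "'b::ab_group_add set"
  assumes "turyn_group A u" "turyn_group B v"
  shows "turyn_group (A \<times> B) (u * v)"
proof -
  have AB: "subgrp A" "subgrp B" "card A = u\<^sup>2" "card B = v\<^sup>2"
    using assms by (auto simp: turyn_group_def)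
  obtain f0 f1 f2 f3 where f: "even_sign A f0" "even_sign A f1" "even_sign A f2" "even_sign A f3"
    and fc: "\<And>x. x \<in> A \<Longrightarrow> conv A f0 f0 x + conv A f1 f1 x + conv A f2 f2 x + conv A f3 f3 x
                = (if x = 0 then 4 * real (u\<^sup>2) else 0) \<and>
              conv A f0 f1 x + conv A f2 f3 x = 0 \<and>
              conv A f0 f2 x + conv A f1 f3 x = 0 \<and>
              conv A f0 f3 x + conv A f1 f2 x = 0"
    using assms(1) unfolding turyn_group_def by metis
  obtain g0 g1 g2 g3 where g: "even_sign B g0" "even_sign B g1" "even_sign B g2" "even_sign B g3"
    and gc: "\<And>x. x \<in> B \<Longrightarrow> conv B g0 g0 x + conv B g1 g1 x + conv B g2 g2 x + conv B g3 g3 x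
                = (if x = 0 then 4 * real (v\<^sup>2) else 0) \<and>
              conv B g0 g1 x + conv B g2 g3 x = 0 \<and>
              conv B g0 g2 x + conv B g1 g3 x = 0 \<and>
              conv B g0 g3 x + conv B g1 g2 x = 0"
    using assms(2) unfolding turyn_group_def by metis
  define w where "w x = (f0 x + f1 x) / 2" for x
  define x where "x t = (f0 t - f1 t) / 2" for t
  define y where "y x = (f2 x + f3 x) / 2" for x
  define z where "z x = (f2 x - f3 x) / 2" for x
  note wxyz = w_def x_def y_def z_def
  have wc: "conv A w y a = 0" "conv A x z a = 0"
    "conv A y y a = (if a = 0 then real (u\<^sup>2) else 0) - conv A w w a"
    "conv A z z a = (if a = 0 then real (u\<^sup>2) else 0) - conv A x x a"
    if "a \<in> A" for a
    unfolding wxyz conv_linear using fc[OF that]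
    by (auto simp: field_simps conv_commute[OF AB(1) that, of f1 f0] conv_commute[OF AB(1) that, of f3 f2]
       split: if_splits)
  define p where "p k l = (\<lambda>t. w (fst t) * k (snd t) + x (fst t) * l (snd t))" for k l :: "'b \<Rightarrow> real"
  define q where "q k l = (\<lambda>t. y (fst t) * k (snd t) + z (fst t) * l (snd t))" for k l :: "'b \<Rightarrow> real"
  have sgn: "even_sign (A \<times> B) (p k l)" "even_sign (A \<times> B) (q k l)"
    if "even_sign B k" "even_sign B l" for k l
    unfolding p_def q_def wxyz using even_sign_half_sum_diff that f by blast+
  have "conv (A \<times> B) (p g0 g1) (p g0 g1) t + conv (A \<times> B) (p g2 g3) (p g2 g3) t +
      conv (A \<times> B) (q g0 g1) (q g0 g1) t + conv (A \<times> B) (q g2 g3) (q g2 g3) t =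
      (if t = 0 then 4 * real ((u * v)\<^sup>2) else 0)" (is ?E1)
    "conv (A \<times> B) (p g0 g1) (p g2 g3) t + conv (A \<times> B) (q g0 g1) (q g2 g3) t = 0" (is ?E2)
    "conv (A \<times> B) (p g0 g1) (q g0 g1) t + conv (A \<times> B) (p g2 g3) (q g2 g3) t = 0" (is ?E3)
    "conv (A \<times> B) (p g0 g1) (q g2 g3) t + conv (A \<times> B) (p g2 g3) (q g0 g1) t = 0" (is ?E4)
    if t: "t \<in> A \<times> B" for t
  proof -
    obtain a b where ab: "a \<in> A" "b \<in> B" "t = (a, b)" using t by auto
    \<comment> \<open>Orienting all commutations gives each product one normal form, so that equal
      terms can cancel.\<close>
    note [simp] = conv_commute[OF AB(1) ab(1), of x w] conv_commute[OF AB(1) ab(1), of y w]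
      conv_commute[OF AB(1) ab(1), of z w] conv_commute[OF AB(1) ab(1), of y x]
      conv_commute[OF AB(1) ab(1), of z x] conv_commute[OF AB(1) ab(1), of z y]
      conv_commute[OF AB(2) ab(2), of g1 g0] conv_commute[OF AB(2) ab(2), of g2 g0]
      conv_commute[OF AB(2) ab(2), of g3 g0] conv_commute[OF AB(2) ab(2), of g2 g1]
      conv_commute[OF AB(2) ab(2), of g3 g1] conv_commute[OF AB(2) ab(2), of g3 g2]
    have pp: "conv (A \<times> B) (p k l) (p k' l') t = conv A w w a * conv B k k' b +
       conv A w x a * conv B k l' b + conv A w x a * conv B l k' b + conv A x x a * conv B l l' b"
      and qq: "conv (A \<times> B) (q k l) (q k' l') t = conv A y y a * conv B k k' b +
       conv A y z a * conv B k l' b + conv A y z a * conv B l k' b + conv A z z a * conv B l l' b"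
      and pq: "conv (A \<times> B) (p k l) (q k' l') t = conv A w y a * conv B k k' b +
       conv A w z a * conv B k l' b + conv A x y a * conv B l k' b + conv A x z a * conv B l l' b"
      for k l k' l'
      by (simp_all add: p_def q_def conv_add_left conv_add_right conv_prod ab)
    have g3: "conv B g3 g3 b = (if b = 0 then 4 * real (v\<^sup>2) else 0) - conv B g0 g0 b - conv B g1 g1 b - conv B g2 g2 b"
      "conv B g2 g3 b = - conv B g0 g1 b" "conv B g1 g3 b = - conv B g0 g2 b"
      "conv B g1 g2 b = - conv B g0 g3 b"
      using gc[OF ab(2)] by (simp_all add: algebra_simps split del: if_split)
    have t0: "t = 0 \<longleftrightarrow> a = 0 \<and> b = 0" by (simp add: ab zero_prod_def)
    \<comment> \<open>In the first two relations the pure terms carry the factors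
      \<open>w * w + y * y\<close> and \<open>x * x + z * z\<close>, both \<open>u\<^sup>2\<close>
      times the unit; in the last two they carry \<open>w * y\<close> and \<open>x * z\<close>, both
      zero. The mixed terms always carry \<open>g0 * g1 + g2 * g3\<close> or
      \<open>g0 * g3 + g1 * g2\<close>, which vanish.\<close>
    show ?E1 unfolding pp qq by (simp add: wc[OF ab(1)] g3 t0 algebra_simps power_mult_distrib)
    show ?E2 unfolding pp qq by (simp add: wc[OF ab(1)] g3 algebra_simps)
    show ?E3 unfolding pq by (simp add: wc[OF ab(1)] g3 algebra_simps)
    show ?E4 unfolding pq by (simp add: wc[OF ab(1)] g3 algebra_simps)
  qed
  moreover have "subgrp (A \<times> B)" "card (A \<times> B) = (u * v)\<^sup>2"
    using AB by (simp_all add: subgrp_prod card_cartesian_product power_mult_distrib)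
  ultimately show ?thesis unfolding turyn_group_def
    using sgn[OF g(1,2)] sgn[OF g(3,4)] by blast
qed

section \<open>From Turyn groups to Hadamard groups and triple arrays\<close>

lemma UNIV_bit: "(UNIV :: bit set) = {0, 1}"
  by (auto intro: bit.exhaust)

lemma UNIV_bit_bit: "(UNIV :: (bit \<times> bit) set) = {(0, 0), (0, 1), (1, 0), (1, 1)}"
  by (auto simp: UNIV_bit simp flip: UNIV_Times_UNIV)

lemma sum_bit_bit:
  fixes g :: "bit \<times> bit \<Rightarrow> real"
  shows "(\<Sum>k\<in>UNIV. g k) = g (0, 0) + g (0, 1) + g (1, 0) + g (1, 1)"
  unfolding UNIV_bit_bit by simp

text \<open>Each coset of \<open>H\<close> carries one of the four functions. The square, restricted
  to a coset, is the sum of the products whose indices add up to that coset: the relation on squares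
  at the identity, twice a vanishing relation elsewhere.\<close>

lemma hadamard_group_of_turyn_group:
  assumes "turyn_group H u"
  shows "hadamard_group ((UNIV :: (bit \<times> bit) set) \<times> H) u"
proof -
  have H: "subgrp H" "card H = u\<^sup>2" using assms by (auto simp: turyn_group_def)
  obtain f0 f1 f2 f3 where f: "even_sign H f0" "even_sign H f1" "even_sign H f2" "even_sign H f3"
    and fc: "\<And>x. x \<in> H \<Longrightarrow> conv H f0 f0 x + conv H f1 f1 x + conv H f2 f2 x + conv H f3 f3 x
                = (if x = 0 then 4 * real (u\<^sup>2) else 0) \<and>
              conv H f0 f1 x + conv H f2 f3 x = 0 \<and>
              conv H f0 f2 x + conv H f1 f3 x = 0 \<and>
              conv H f0 f3 x + conv H f1 f2 x = 0"
    using assms(1) unfolding turyn_group_def by metis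
  define F :: "bit \<times> bit \<Rightarrow> _" where "F k = (if k = (0,0) then f0 else if k = (0,1) then f1 else
     if k = (1,0) then f2 else f3)" for k
  define h where "h z = F (fst z) (snd z)" for z
  let ?G = "(UNIV :: (bit \<times> bit) set) \<times> H"
  have U: "subgrp (UNIV :: (bit \<times> bit) set)" "card (UNIV :: (bit \<times> bit) set) = 4"
    by (simp_all add: subgrp_def UNIV_bit_bit zero_prod_def)
  have G: "subgrp ?G" "card ?G = 4 * u\<^sup>2"
    using H U by (simp_all add: subgrp_prod card_cartesian_product)
  have "even_sign ?G h"
    using f by (auto simp: even_sign_def h_def F_def)
  moreover have "conv ?G h h z = (if z = 0 then 4 * real (u\<^sup>2) else 0)" if "z \<in> ?G" for z
  proof -
    obtain k x where z: "z = (k, x)" "x \<in> H" using \<open>z \<in> ?G\<close> by auto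
    have "conv ?G h h z = (\<Sum>k'\<in>UNIV. conv H (F k') (F (k - k')) x)"
      unfolding conv_def sum.cartesian_product z by (simp add: h_def case_prod_unfold)
    also have "\<dots> = (if z = 0 then 4 * real (u\<^sup>2) else 0)"
    proof -
      note f_rel = fc[OF z(2)]
      have r: "conv H f3 f3 x = (if x = 0 then 4 * real (u\<^sup>2) else 0)
          - conv H f0 f0 x - conv H f1 f1 x - conv H f2 f2 x"
        "conv H f2 f3 x = - conv H f0 f1 x" "conv H f1 f3 x = - conv H f0 f2 x"
        "conv H f1 f2 x = - conv H f0 f3 x"
        using f_rel by (simp_all add: algebra_simps split del: if_split)
      have c: "conv H f1 f0 x = conv H f0 f1 x" "conv H f2 f0 x = conv H f0 f2 x"
        "conv H f3 f0 x = conv H f0 f3 x" "conv H f2 f1 x = conv H f1 f2 x"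
        "conv H f3 f1 x = conv H f1 f3 x" "conv H f3 f2 x = conv H f2 f3 x"
        by (rule conv_commute[OF H(1) z(2)])+
      have "k = (0, 0) \<or> k = (0, 1) \<or> k = (1, 0) \<or> k = (1, 1)"
        using UNIV_bit_bit by blast
      moreover have "F 0 = f0" "F (0, 0) = f0" "F (0, 1) = f1" "F (1, 0) = f2" "F (1, 1) = f3"
        by (simp_all add: F_def zero_prod_def)
      moreover have "z = 0 \<longleftrightarrow> k = (0, 0) \<and> x = 0" by (simp add: z zero_prod_def)
      ultimately show ?thesis
        unfolding sum_bit_bit by (elim disjE) (simp_all add: c r)
    qed
    finally show ?thesis .
  qed
  ultimately show ?thesis unfolding hadamard_group_def using G by blast
qed

text \<open>The difference set is where the sign function equals -1, with indicator
  \<open>(1 - h) / 2\<close>. The sum of the function squares to \<open>4 * u\<^sup>2\<close>; after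
  a change of sign it is \<open>2 * u\<close>, which selects the smaller size
  \<open>2 * u\<^sup>2 - u\<close>. Multiplying out two indicators gives the intersection number
  \<open>u\<^sup>2 - u\<close>.\<close>

theorem triple_array_of_hadamard_group:
  assumes "hadamard_group H u" "u > 0"
  shows "\<exists>(V :: nat set) A. triple_array (4 * u\<^sup>2 - 1) (u\<^sup>2) (u\<^sup>2 + u) (u\<^sup>2 - u) (u\<^sup>2)
           (2 * u\<^sup>2 - u) (2 * u\<^sup>2 + u) V A"
proof -
  have H: "subgrp H" "card H = 4 * u\<^sup>2" using assms by (auto simp: hadamard_group_def)
  obtain g where g: "even_sign H g" "\<And>x. x \<in> H \<Longrightarrow> conv H g g x = (if x = 0 then 4 * real (u\<^sup>2) else 0)"
    using assms(1) unfolding hadamard_group_def by blast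
  have "(sum g H)\<^sup>2 = (\<Sum>x\<in>H. if x = 0 then 4 * real (u\<^sup>2) else 0)"
    using sum_conv[OF H(1), of g g] g(2) by (simp add: power2_eq_square)
  also have "\<dots> = (2 * real u)\<^sup>2"
    using H(1) by (simp add: subgrp_simps power_mult_distrib)
  finally have S: "sum g H = 2 * real u \<or> sum g H = - (2 * real u)"
    by (simp only: power2_eq_iff)
  obtain h where h: "even_sign H h" "\<And>x. x \<in> H \<Longrightarrow> conv H h h x = (if x = 0 then 4 * real (u\<^sup>2) else 0)"
    "sum h H = 2 * real u"
  proof (cases "sum g H = 2 * real u")
    case True then show ?thesis using g that by blast
  next
    case False
    then show ?thesis using g S
      by (intro that[of "\<lambda>x. - g x"]) (auto simp: even_sign_def conv_linear sum_negf)
  qed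
  define D where "D = {x\<in>H. h x = -1}"
  have fH: "finite H" using H subgrp_finite by blast
  have ind: "(if x \<in> D then 1 else 0) = (1 - h x) / 2" if "x \<in> H" for x
    using h(1) that by (auto simp: even_sign_def D_def)
  have DH: "D \<subseteq> H" by (auto simp: D_def)
  have u2: "u \<le> u\<^sup>2" by (simp add: power2_eq_square)
  have "real (card D) = (\<Sum>x\<in>H. if x \<in> D then 1 else 0)"
    using fH DH by (simp add: Int_absorb1 flip: sum.inter_restrict)
  also have "\<dots> = (\<Sum>x\<in>H. (1 - h x) / 2)" by (intro sum.cong ind refl)
  also have "\<dots> = 2 * real (u\<^sup>2) - real u"
    using h(3) H(2) by (simp add: sum_subtractf flip: sum_divide_distrib)
  also have "\<dots> = real (2 * u\<^sup>2 - u)" using u2 by (simp add: of_nat_diff)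
  finally have cD: "card D = 2 * u\<^sup>2 - u" by linarith
  have l: "card {y\<in>D. y - x \<in> D} = u\<^sup>2 - u" if x: "x \<in> H" "x \<noteq> 0" for x
  proof -
    have sub: "{y\<in>D. y - x \<in> D} \<subseteq> H" using DH by auto
    \<comment> \<open>Evenness turns the correlation at \<open>y - x\<close> into the convolution at
      \<open>x - y\<close>.\<close>
    have ev: "h (y - x) = h (x - y)" if "y \<in> H" for y
      using h(1) subgrp_diff[OF H(1) that x(1)] by (auto simp: even_sign_def)
    have "real (card {y\<in>D. y - x \<in> D}) = (\<Sum>y\<in>H. if y \<in> {y\<in>D. y - x \<in> D} then 1 else 0)"
      using fH sub by (simp only: sum.inter_restrict[symmetric]) (simp add: Int_absorb1)
    also have "\<dots> = (\<Sum>y\<in>H. (1 - h y) / 2 * ((1 - h (x - y)) / 2))"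
    proof (rule sum.cong[OF refl])
      fix y assume y: "y \<in> H"
      then show "(if y \<in> {y\<in>D. y - x \<in> D} then 1 else 0) = (1 - h y) / 2 * ((1 - h (x - y)) / 2)"
        using ind[OF y] ind[OF subgrp_diff[OF H(1) y x(1)]] ev[OF y] by auto
    qed
    also have "\<dots> = (\<Sum>y\<in>H. (1 - h y - h (x - y) + h y * h (x - y)) / 4)"
      by (intro sum.cong refl) (simp add: field_simps)
    also have "\<dots> = (real (card H) - sum h H - (\<Sum>y\<in>H. h (x - y)) + conv H h h x) / 4"
      by (simp add: sum_subtractf sum.distrib conv_def flip: sum_divide_distrib)
    also have "(\<Sum>y\<in>H. h (x - y)) = sum h H"
      by (rule sum.reindex_bij_witness[of _ "\<lambda>y. x - y" "\<lambda>y. x - y"])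
         (use H x in \<open>auto simp: subgrp_simps\<close>)
    finally have "real (card {y\<in>D. y - x \<in> D}) = real (u\<^sup>2) - real u"
      using h(2)[OF x(1)] x h(3) H(2) by simp
    also have "\<dots> = real (u\<^sup>2 - u)" using u2 by (simp add: of_nat_diff)
    finally show ?thesis by (simp only: of_nat_eq_iff)
  qed
  have "- x \<in> D" if "x \<in> D" for x
    using that h(1) H by (auto simp: D_def even_sign_def subgrp_simps)
  from triple_array_of_difference_set[OF H(1,2) DH cD this l]
  have "\<exists>(V :: nat set) A. triple_array (4 * u\<^sup>2 - 1) (2 * u\<^sup>2 - u - (u\<^sup>2 - u))
     (4 * u\<^sup>2 + (u\<^sup>2 - u) - 2 * (2 * u\<^sup>2 - u)) (u\<^sup>2 - u) (2 * u\<^sup>2 - u - (u\<^sup>2 - u))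
     (2 * u\<^sup>2 - u) (4 * u\<^sup>2 - (2 * u\<^sup>2 - u)) V A" by blast
  moreover have "2 * u\<^sup>2 - u - (u\<^sup>2 - u) = u\<^sup>2" "4 * u\<^sup>2 + (u\<^sup>2 - u) - 2 * (2 * u\<^sup>2 - u) = u\<^sup>2 + u"
    "4 * u\<^sup>2 - (2 * u\<^sup>2 - u) = 2 * u\<^sup>2 + u" using u2 by linarith+
  ultimately show ?thesis by metis
qed

section \<open>Lines in a plane over a finite field\<close>

text \<open>Minus signs on the smaller half leave a surplus of one. The signs will weight an odd
  number of lines through the origin, so that the weighted sum of lines has value 1 there.\<close>

lemma odd_card_sign_sum_one:
  assumes "odd (card A)"
  obtains w :: "'a \<Rightarrow> real" where "\<And>a. a \<in> A \<Longrightarrow> w a = 1 \<or> w a = -1" "sum w A = 1"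
proof -
  have fA: "finite A" using assms by (metis card.infinite even_zero)
  obtain B where B: "B \<subseteq> A" "card B = card A div 2"
    using obtain_subset_with_card_n[of "card A div 2" A] by (metis div_le_dividend)
  define w :: "'a \<Rightarrow> real" where "w a = 1 - 2 * (if a \<in> B then 1 else 0)" for a
  have "sum w A = real (card A) - 2 * real (card B)"
    using fA B(1) by (simp add: w_def sum_subtractf Int_absorb1 flip: sum_distrib_left sum.inter_restrict)
  also have "real (card A) = 2 * real (card B) + 1"
    using assms B(2) by (metis odd_two_times_div_two_succ of_nat_1 of_nat_add of_nat_mult of_nat_numeral)
  finally have "sum w A = 1" by simp
  then show thesis using that[of w] by (simp add: w_def)
qed

text \<open>As \<open>A\<close> and \<open>B\<close> meet only in 0, the decomposition
  \<open>x + y\<close> is unique and a single term of the convolution survives.\<close>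

lemma conv_complementary:
  assumes "subgrp H" "subgrp A" "subgrp B" "A \<subseteq> H" "A \<inter> B = {0}" "x \<in> A" "y \<in> B"
    and f: "\<And>w. w \<notin> A \<Longrightarrow> f w = 0" and g: "\<And>w. w \<notin> B \<Longrightarrow> g w = 0"
  shows "conv H f g (x + y) = f x * g y"
proof -
  have "f w * g (x + y - w) = 0" if "w \<noteq> x" for w
  proof (rule ccontr)
    assume "\<not> ?thesis"
    then have "w \<in> A" "x + y - w \<in> B" using f g by auto
    then have "x - w \<in> A" "(x + y - w) - y \<in> B"
      using subgrp_diff[OF assms(2,6)] subgrp_diff[OF assms(3) _ assms(7)] by blast+
    moreover have "(x + y - w) - y = x - w" by simp
    ultimately have "x - w \<in> A \<inter> B" by simp
    then show False using assms(5) that by simp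
  qed
  then have "conv H f g (x + y) = (\<Sum>w\<in>{x}. f w * g (x + y - w))"
    unfolding conv_def using assms by (intro sum.mono_neutral_right) (auto simp: subgrp_simps)
  then show ?thesis by simp
qed

lemma conv_supported:
  assumes "subgrp H" "subgrp A" "A \<subseteq> H"
    and f: "\<And>w. w \<notin> A \<Longrightarrow> f w = 0" and g: "\<And>w. w \<notin> A \<Longrightarrow> g w = 0"
  shows "conv H f g x = (if x \<in> A then conv A f g x else 0)"
proof -
  have "conv H f g x = conv A f g x"
    unfolding conv_def using assms by (intro sum.mono_neutral_right) (auto simp: subgrp_simps)
  moreover have "conv A f g x = 0" if "x \<notin> A"
    unfolding conv_def
  proof (rule sum.neutral, rule ballI)
    fix w assume "w \<in> A"
    then have "x - w \<notin> A" using that subgrp_add[OF assms(2), of "x - w" w] by auto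
    then show "f w * g (x - w) = 0" using g by simp
  qed
  ultimately show ?thesis by simp
qed

text \<open>A finite field sitting inside a commutative ring type, with its own unit \<open>e\<close>. This makes all finite
  fields available inside one fixed type.\<close>
locale field_set =
  fixes K :: "'a::comm_ring set" and e :: 'a
  assumes K: "subgrp K" and eK: "e \<in> K" and e_nz: "e \<noteq> 0"
    and mult_K: "x \<in> K \<Longrightarrow> y \<in> K \<Longrightarrow> x * y \<in> K"
    and e_mult: "x \<in> K \<Longrightarrow> e * x = x"
    and ex_inv: "x \<in> K \<Longrightarrow> x \<noteq> 0 \<Longrightarrow> \<exists>y\<in>K. x * y = e"
begin

lemmas K_simps [simp] = subgrp_finite[OF K] subgrp_zero[OF K] subgrp_diff[OF K] subgrp_minus[OF K]
  subgrp_add[OF K] eK e_nz mult_K e_mult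

lemma mult_e [simp]: "x \<in> K \<Longrightarrow> x * e = x"
  by (simp add: mult.commute[of x])

definition finv :: "'a \<Rightarrow> 'a" where "finv x = (SOME y. y \<in> K \<and> x * y = e)"

lemma finv [simp]:
  assumes "x \<in> K" "x \<noteq> 0" shows "finv x \<in> K" "x * finv x = e" "finv x * x = e"
  using someI_ex[of "\<lambda>y. y \<in> K \<and> x * y = e"] ex_inv[OF assms]
  unfolding finv_def by (auto simp: mult.commute)

lemma mult_eq_0_K [simp]:
  assumes "x \<in> K" "y \<in> K" shows "x * y = 0 \<longleftrightarrow> x = 0 \<or> y = 0"
proof
  assume xy: "x * y = 0"
  show "x = 0 \<or> y = 0"
  proof (rule ccontr)
    assume "\<not> ?thesis"
    then have "y = (finv x * x) * y" using assms by simp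
    also have "\<dots> = finv x * (x * y)" by (simp add: mult.assoc)
    finally show False using xy \<open>\<not> _\<close> by simp
  qed
qed auto

lemma mult_left_cancel_K:
  assumes "x \<in> K" "y \<in> K" "z \<in> K" "x \<noteq> 0" "x * y = x * z"
  shows "y = z"
proof -
  have "x * (y - z) = 0" using assms by (simp add: algebra_simps)
  then show ?thesis using assms by simp
qed

lemma sum_shift_K: "a \<in> K \<Longrightarrow> (\<Sum>x\<in>K. f (x + a)) = (\<Sum>x\<in>K. f x :: real)"
  by (rule sum.reindex_bij_witness[of _ "\<lambda>x. x - a" "\<lambda>x. x + a"]) auto

lemma sum_reflect_K: "a \<in> K \<Longrightarrow> (\<Sum>x\<in>K. f (a - x)) = (\<Sum>x\<in>K. f x :: real)"
  by (rule sum.reindex_bij_witness[of _ "\<lambda>x. a - x" "\<lambda>x. a - x"]) auto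

lemma sum_scale_K:
  assumes "a \<in> K" "a \<noteq> 0"
  shows "(\<Sum>x\<in>K. f (a * x)) = (\<Sum>x\<in>K. f x :: real)"
proof (rule sum.reindex_bij_witness[of _ "\<lambda>x. finv a * x" "\<lambda>x. a * x"])
  fix x assume x: "x \<in> K"
  show "finv a * (a * x) = x" "a * (finv a * x) = x"
    using assms x by (simp_all flip: mult.assoc)
qed (use assms in auto)

section \<open>The affine plane and its lines through the origin\<close>

definition smul :: "'a \<Rightarrow> 'a \<times> 'a \<Rightarrow> 'a \<times> 'a" where "smul l v = (l * fst v, l * snd v)"

definition det :: "'a \<times> 'a \<Rightarrow> 'a \<times> 'a \<Rightarrow> 'a" where "det v w = fst v * snd w - snd v * fst w"

text \<open>The projective line over \<open>K\<close>, with \<open>None\<close> as the point at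
  infinity. Below, \<open>rep\<close> normalises one entry of a representative to \<open>e\<close>,
  and \<open>coord\<close> reads off that entry, hence the multiple of the representative.\<close>

definition points :: "'a option set" where "points = insert None (Some ` K)"

fun rep :: "'a option \<Rightarrow> 'a \<times> 'a" where "rep None = (0, e)" | "rep (Some a) = (e, a)"

fun coord :: "'a option \<Rightarrow> 'a \<times> 'a \<Rightarrow> 'a" where "coord None v = snd v" | "coord (Some a) v = fst v"

definition line :: "'a option \<Rightarrow> ('a \<times> 'a) set" where "line p = {v \<in> K \<times> K. det (rep p) v = 0}"

lemma finite_points [simp]: "finite points" by (simp add: points_def)

lemma card_points: "card points = card K + 1"
  by (simp add: points_def card_image)

lemma sum_points: "sum f points = f None + (\<Sum>a\<in>K. f (Some a) :: real)"
  by (simp add: points_def sum.reindex)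

lemma rep_in [simp]: "p \<in> points \<Longrightarrow> rep p \<in> K \<times> K"
  by (auto simp: points_def)

lemma det_in [simp]: "v \<in> K \<times> K \<Longrightarrow> w \<in> K \<times> K \<Longrightarrow> det v w \<in> K"
  by (auto simp: det_def)

lemma smul_in [simp]: "l \<in> K \<Longrightarrow> v \<in> K \<times> K \<Longrightarrow> smul l v \<in> K \<times> K"
  by (auto simp: smul_def)

lemma det_self [simp]: "det v v = 0" by (simp add: det_def mult.commute)

lemma det_smul: "det (smul l v) w = l * det v w" by (simp add: det_def smul_def algebra_simps)

lemma det_swap: "det w v = - det v w" by (simp add: det_def algebra_simps)

lemma det_rep_eq_0_iff:
  assumes "a \<in> points" "b \<in> points" shows "det (rep a) (rep b) = 0 \<longleftrightarrow> a = b"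
  using assms by (auto simp: points_def det_def)

lemma coord_smul [simp]: "p \<in> points \<Longrightarrow> l \<in> K \<Longrightarrow> coord p (smul l (rep p)) = l"
  by (auto simp: points_def smul_def)

lemma coord_in [simp]: "v \<in> K \<times> K \<Longrightarrow> coord p v \<in> K"
  by (cases p) auto

lemma line_coord:
  assumes "p \<in> points" "v \<in> line p" shows "v = smul (coord p v) (rep p)"
  using assms by (auto simp: points_def line_def det_def smul_def prod_eq_iff algebra_simps)

lemma smul_in_line [simp]: "p \<in> points \<Longrightarrow> l \<in> K \<Longrightarrow> smul l (rep p) \<in> line p"
  using det_smul[of l "rep p" "rep p"] det_swap[of "rep p" "smul l (rep p)"] by (simp add: line_def)

lemma line_image: "p \<in> points \<Longrightarrow> line p = (\<lambda>l. smul l (rep p)) ` K"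
proof (intro equalityI subsetI)
  fix v assume p: "p \<in> points" and v: "v \<in> line p"
  then have "coord p v \<in> K" by (simp add: line_def)
  then show "v \<in> (\<lambda>l. smul l (rep p)) ` K" using line_coord[OF p v] by blast
qed auto

lemma inj_on_smul_rep: "p \<in> points \<Longrightarrow> inj_on (\<lambda>l. smul l (rep p)) K"
  by (rule inj_on_inverseI[of _ "coord p"]) simp

lemma line_subset: "line p \<subseteq> K \<times> K" by (auto simp: line_def)

lemma subgrp_plane: "subgrp (K \<times> K)" by (intro subgrp_prod K)

lemma subgrp_line: "p \<in> points \<Longrightarrow> subgrp (line p)"
  using subgrp_finite[OF subgrp_plane]
  by (auto simp: subgrp_def line_def det_def zero_prod_def algebra_simps intro: finite_subset)

lemma smul_diff: "smul l v - smul k v = smul (l - k) v"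
  by (simp add: smul_def algebra_simps)

text \<open>Two distinct lines span the plane. The coefficients are kept explicit because the
  quadratic character will be evaluated at them.\<close>

lemma cramer:
  assumes "a \<in> points" "b \<in> points" "a \<noteq> b" "v \<in> K \<times> K"
  shows "v = smul (det v (rep b) * finv (det (rep a) (rep b))) (rep a)
     + smul (det (rep a) v * finv (det (rep a) (rep b))) (rep b)"
proof -
  obtain v1 v2 a1 a2 b1 b2 where v: "v = (v1, v2)" "rep a = (a1, a2)" "rep b = (b1, b2)"
    by (metis prod.collapse)
  have K: "v1 \<in> K" "v2 \<in> K" "a1 \<in> K" "a2 \<in> K" "b1 \<in> K" "b2 \<in> K"
    using assms rep_in[of a] rep_in[of b] by (auto simp: v)
  let ?D = "a1 * b2 - a2 * b1"
  have D: "?D \<in> K" "?D \<noteq> 0" using K det_rep_eq_0_iff[OF assms(1,2)] assms(3) by (auto simp: v det_def)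
  have inv: "?D * finv ?D = e" using D by simp
  have "(v1 * b2 - v2 * b1) * finv ?D * a1 + (a1 * v2 - a2 * v1) * finv ?D * b1 = (?D * finv ?D) * v1"
    "(v1 * b2 - v2 * b1) * finv ?D * a2 + (a1 * v2 - a2 * v1) * finv ?D * b2 = (?D * finv ?D) * v2"
    by (simp_all add: algebra_simps)
  then show ?thesis using K unfolding inv by (simp add: v det_def smul_def)
qed

lemma line_inter: "a \<in> points \<Longrightarrow> b \<in> points \<Longrightarrow> a \<noteq> b \<Longrightarrow> line a \<inter> line b = {0}"
proof -
  assume ab: "a \<in> points" "b \<in> points" "a \<noteq> b"
  have "v = 0" if "v \<in> line a" "v \<in> line b" for v
  proof -
    have v: "v \<in> K \<times> K" "det (rep a) v = 0" "det v (rep b) = 0"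
      using that by (auto simp: line_def det_swap[of v "rep b"])
    show ?thesis using cramer[OF ab v(1)] unfolding v(2,3) by (simp add: smul_def zero_prod_def)
  qed
  then show ?thesis using subgrp_zero[OF subgrp_line] ab by blast
qed

lemma nonzero_vector:
  assumes "v \<in> K \<times> K" "v \<noteq> 0"
  obtains c l where "c \<in> points" "l \<in> K" "l \<noteq> 0" "v = smul l (rep c)"
proof (cases "fst v = 0")
  case True
  then show ?thesis using assms
    by (intro that[of None "snd v"]) (auto simp: points_def smul_def zero_prod_def)
next
  case False
  then show ?thesis using assms
    by (intro that[of "Some (finv (fst v) * snd v)" "fst v"])
       (auto simp: points_def smul_def prod_eq_iff simp flip: mult.assoc)
qed

definition supp_line :: "('a \<Rightarrow> real) \<Rightarrow> 'a option \<Rightarrow> 'a \<times> 'a \<Rightarrow> real" where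
  "supp_line \<alpha> p v = (if v \<in> line p then \<alpha> (coord p v) else 0)"

lemma supp_line_smul [simp]:
  "p \<in> points \<Longrightarrow> l \<in> K \<Longrightarrow> supp_line \<alpha> p (smul l (rep p)) = \<alpha> l"
  by (simp add: supp_line_def)

text \<open>The plane is the direct sum of two distinct lines, so the convolution is the product of
  the values at the two Cramer coordinates.\<close>

lemma conv_supp_line_distinct:
  assumes "a \<in> points" "b \<in> points" "a \<noteq> b" "v \<in> K \<times> K"
  shows "conv (K \<times> K) (supp_line \<alpha> a) (supp_line \<beta> b) v =
    \<alpha> (det v (rep b) * finv (det (rep a) (rep b))) * \<beta> (det (rep a) v * finv (det (rep a) (rep b)))"
proof -
  have D: "det (rep a) (rep b) \<in> K" "det (rep a) (rep b) \<noteq> 0"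
    using assms det_rep_eq_0_iff by auto
  have l: "det v (rep b) * finv (det (rep a) (rep b)) \<in> K" "det (rep a) v * finv (det (rep a) (rep b)) \<in> K"
    using assms D by auto
  have "conv (K \<times> K) (supp_line \<alpha> a) (supp_line \<beta> b)
      (smul (det v (rep b) * finv (det (rep a) (rep b))) (rep a)
       + smul (det (rep a) v * finv (det (rep a) (rep b))) (rep b)) =
    supp_line \<alpha> a (smul (det v (rep b) * finv (det (rep a) (rep b))) (rep a)) *
    supp_line \<beta> b (smul (det (rep a) v * finv (det (rep a) (rep b))) (rep b))"
    by (rule conv_complementary[OF subgrp_plane subgrp_line[OF assms(1)] subgrp_line[OF assms(2)]
        line_subset line_inter[OF assms(1-3)]])
       (use assms l in \<open>auto simp: supp_line_def simp del: mem_Sigma_iff\<close>)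
  then show ?thesis using cramer[OF assms] l assms(1,2) by simp
qed

lemma conv_supp_line_same:
  assumes "a \<in> points"
  shows "conv (K \<times> K) (supp_line \<alpha> a) (supp_line \<beta> a) v =
    (if v \<in> line a then conv K \<alpha> \<beta> (coord a v) else 0)"
proof -
  have "conv (line a) (supp_line \<alpha> a) (supp_line \<beta> a) v = conv K \<alpha> \<beta> (coord a v)" if v: "v \<in> line a"
  proof -
    have c: "coord a v \<in> K" using v line_subset by (intro coord_in) blast
    have "conv (line a) (supp_line \<alpha> a) (supp_line \<beta> a) v =
      (\<Sum>l\<in>K. supp_line \<alpha> a (smul l (rep a)) * supp_line \<beta> a (smul (coord a v) (rep a) - smul l (rep a)))"
      unfolding conv_def using line_coord[OF assms v]
      by (simp add: line_image[OF assms] sum.reindex[OF inj_on_smul_rep[OF assms]])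
    also have "\<dots> = conv K \<alpha> \<beta> (coord a v)"
      unfolding conv_def smul_diff using assms c by (intro sum.cong) auto
    finally show ?thesis .
  qed
  then show ?thesis
    by (subst conv_supported[OF subgrp_plane subgrp_line[OF assms] line_subset])
       (auto simp: supp_line_def)
qed

lemma line_minus_iff: "v \<in> K \<times> K \<Longrightarrow> - v \<in> line p \<longleftrightarrow> v \<in> line p"
proof -
  have "det (rep p) (- v) = - det (rep p) v" by (simp add: det_def)
  moreover assume "v \<in> K \<times> K"
  then have "- v \<in> K \<times> K" using subgrp_minus[OF subgrp_plane] by blast
  ultimately show ?thesis using \<open>v \<in> K \<times> K\<close> by (simp add: line_def)
qed

lemma supp_line_minus:
  assumes "v \<in> K \<times> K" "\<And>x. x \<in> K \<Longrightarrow> \<alpha> (- x) = \<alpha> x"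
  shows "supp_line \<alpha> p (- v) = supp_line \<alpha> p v"
proof -
  have "coord p (- v) = - coord p v" by (cases p) simp_all
  then show ?thesis using assms line_minus_iff[OF assms(1)] by (simp add: supp_line_def)
qed

lemma supp_line_smul_rep:
  assumes "a \<in> points" "c \<in> points" "l \<in> K" "l \<noteq> 0"
  shows "supp_line \<alpha> a (smul l (rep c)) = (if a = c then \<alpha> l else 0)"
proof -
  have "smul l (rep c) \<notin> line a" if "a \<noteq> c"
  proof
    assume "smul l (rep c) \<in> line a"
    then have "smul l (rep c) \<in> line a \<inter> line c" using assms by simp
    then have "smul l (rep c) = 0" using line_inter assms that by blast
    then have "coord c (smul l (rep c)) = 0" by (cases c) simp_all
    then show False using assms by simp
  qed
  then show ?thesis using assms by (auto simp: supp_line_def)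
qed

end

section \<open>The quadratic character and the conference matrix\<close>

text \<open>The field of order \<open>q\<^sup>2\<close> over its subfield \<open>F\<close> of order
  \<open>q\<close>, with the quadratic character \<open>\<eta>\<close> of \<open>K\<close>; it is
  trivial on the nonzero elements of \<open>F\<close> because these are squares in \<open>K\<close>.
  The element \<open>d\<close> is a nonsquare, and \<open>e, d\<close> will serve as a basis over
  \<open>F\<close>.\<close>

locale quadratic_field_set = field_set K e for K :: "'a::comm_ring set" and e +
  fixes F :: "'a set" and \<eta> :: "'a \<Rightarrow> real" and q :: nat and d :: 'a
  assumes F: "subgrp F" and F_K: "F \<subseteq> K" and eF: "e \<in> F"
    and mult_F: "x \<in> F \<Longrightarrow> y \<in> F \<Longrightarrow> x * y \<in> F"
    and F_inv: "x \<in> F \<Longrightarrow> x \<noteq> 0 \<Longrightarrow> \<exists>y\<in>F. x * y = e"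
    and card_F: "card F = q" and card_K: "card K = q\<^sup>2" and odd_q: "odd q"
    and \<eta>_0: "\<eta> 0 = 0"
    and \<eta>_sign: "x \<in> K \<Longrightarrow> x \<noteq> 0 \<Longrightarrow> \<eta> x = 1 \<or> \<eta> x = -1"
    and \<eta>_mult: "x \<in> K \<Longrightarrow> y \<in> K \<Longrightarrow> \<eta> (x * y) = \<eta> x * \<eta> y"
    and \<eta>_F: "f \<in> F \<Longrightarrow> f \<noteq> 0 \<Longrightarrow> \<eta> f = 1"
    and dK: "d \<in> K" and \<eta>_d: "\<eta> d = -1"
begin

lemma F_in_K: "x \<in> F \<Longrightarrow> x \<in> K" using F_K by blast

lemma \<eta>_e [simp]: "\<eta> e = 1" using \<eta>_F eF by simp

lemma \<eta>_minus [simp]: "x \<in> K \<Longrightarrow> \<eta> (- x) = \<eta> x"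
  using \<eta>_mult[of "- e" x] \<eta>_F[OF subgrp_minus[OF F eF]] by simp

lemma \<eta>_diff_commute: "x \<in> K \<Longrightarrow> y \<in> K \<Longrightarrow> \<eta> (x - y) = \<eta> (y - x)"
  using \<eta>_minus[of "x - y"] by simp

lemma \<eta>_square: "x \<in> K \<Longrightarrow> \<eta> x * \<eta> x = (if x = 0 then 0 else 1)"
  using \<eta>_sign[of x] \<eta>_0 by auto

lemma \<eta>_finv: "x \<in> K \<Longrightarrow> x \<noteq> 0 \<Longrightarrow> \<eta> (finv x) = \<eta> x"
  using \<eta>_mult[of x "finv x"] \<eta>_sign[of x] by auto

lemma d_nz: "d \<noteq> 0" using \<eta>_d \<eta>_0 by auto

lemma sum_\<eta>: "(\<Sum>x\<in>K. \<eta> x) = 0"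
proof -
  have "(\<Sum>x\<in>K. \<eta> x) = (\<Sum>x\<in>K. \<eta> (d * x))" using sum_scale_K[OF dK d_nz, of \<eta>] by simp
  also have "\<dots> = - (\<Sum>x\<in>K. \<eta> x)" by (simp add: \<eta>_mult dK \<eta>_d sum_negf)
  finally show ?thesis by simp
qed

text \<open>A Jacobsthal sum. For \<open>l \<noteq> 0\<close>, factoring \<open>x\<close> out of
  \<open>l - x\<close> leaves \<open>\<eta> (l / x - e)\<close>, as \<open>\<eta> x\<close> squares
  to 1. Now \<open>l / x\<close> runs over the nonzero elements, so the sum is the full character
  sum 0 without the term \<open>\<eta> (- e) = 1\<close>.\<close>

lemma conv_\<eta>_\<eta>:
  assumes "l \<in> K" shows "conv K \<eta> \<eta> l = (if l = 0 then real (card K) - 1 else -1)"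
proof (cases "l = 0")
  case True
  have "conv K \<eta> \<eta> 0 = (\<Sum>x\<in>K. if x = 0 then 0 else 1)"
    unfolding conv_def by (intro sum.cong) (simp_all add: \<eta>_square)
  also have "\<dots> = (\<Sum>x\<in>K. 1 - (if x = 0 then 1 else 0))" by (intro sum.cong) auto
  also have "\<dots> = real (card K) - 1" by (simp add: sum_subtractf)
  finally show ?thesis using True by simp
next
  case False
  have "conv K \<eta> \<eta> l = (\<Sum>x\<in>K - {0}. \<eta> x * \<eta> (l - x))"
    unfolding conv_def by (intro sum.mono_neutral_right) (auto simp: \<eta>_0)
  also have "\<dots> = (\<Sum>y\<in>K - {0}. \<eta> (y - e))"
  proof -
    have in_K: "l * finv x \<in> K - {0}" if "x \<in> K - {0}" for x
    proof -
      have "finv x \<in> K" "finv x \<noteq> 0" using that finv(2)[of x] by (auto simp del: finv(2,3))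
      then show ?thesis using assms False by simp
    qed
    have invol: "l * finv (l * finv x) = x" if x: "x \<in> K - {0}" for x
    proof (rule mult_left_cancel_K)
      have "(l * finv x) * (l * finv (l * finv x)) = l * ((l * finv x) * finv (l * finv x))"
        by (simp add: mult_ac)
      also have "\<dots> = l * (finv x * x)" using in_K[OF x] x by simp
      finally show "(l * finv x) * (l * finv (l * finv x)) = (l * finv x) * x" by (simp add: mult_ac)
    qed (use in_K[OF x] x assms in auto)
    have val: "\<eta> (l * finv x - e) = \<eta> x * \<eta> (l - x)" if x: "x \<in> K - {0}" for x
    proof -
      have "x * (l * finv x - e) = l * (x * finv x) - x * e" by (simp add: algebra_simps)
      also have "\<dots> = l - x" using x assms by simp
      finally have "\<eta> (l - x) = \<eta> x * \<eta> (l * finv x - e)"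
        using \<eta>_mult[of x "l * finv x - e"] x in_K[OF x] by auto
      then show ?thesis using \<eta>_square[of x] x by (simp flip: mult.assoc)
    qed
    show ?thesis
      by (rule sum.reindex_bij_witness[of _ "\<lambda>y. l * finv y" "\<lambda>x. l * finv x"])
         (use in_K invol val in blast)+
  qed
  also have "\<dots> = (\<Sum>y\<in>K. \<eta> (y + - e)) - \<eta> (0 + - e)"
    by (simp add: sum_diff1)
  also have "\<dots> = -1" using sum_shift_K[of "- e" \<eta>] sum_\<eta> by simp
  finally show ?thesis using False by simp
qed

section \<open>The conference matrix and the convolutions of lines\<close>

definition m :: "'a \<times> 'a \<Rightarrow> 'a option \<Rightarrow> real" where "m v p = \<eta> (det v (rep p))"

lemma m_square:
  assumes "v \<in> K \<times> K" "p \<in> points" shows "m v p * m v p = (if v \<in> line p then 0 else 1)"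
  using \<eta>_square[of "det v (rep p)"] assms det_swap[of v "rep p"] by (auto simp: m_def line_def)

lemma m_rep_square:
  assumes "a \<in> points" "b \<in> points" shows "m (rep a) b * m (rep a) b = (if a = b then 0 else 1)"
  using \<eta>_square[of "det (rep a) (rep b)"] assms by (simp add: m_def det_rep_eq_0_iff)

lemma m_smul: "l \<in> K \<Longrightarrow> v \<in> K \<times> K \<Longrightarrow> p \<in> points \<Longrightarrow> m (smul l v) p = \<eta> l * m v p"
  by (simp add: m_def det_smul \<eta>_mult)

lemma m_zero: "m 0 p = 0"
  by (simp add: m_def det_def \<eta>_0)

text \<open>Under \<open>\<eta>\<close> a quotient becomes a product, and
  \<open>\<eta> (- x) = \<eta> x\<close> makes the orientation of a determinant irrelevant.\<close>

lemma cramer_coeffs: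
  assumes "a \<in> points" "b \<in> points" "a \<noteq> b" "v \<in> K \<times> K"
  shows "\<eta> (det v (rep b) * finv (det (rep a) (rep b))) = m v b * m (rep a) b"
    "\<eta> (det (rep a) v * finv (det (rep a) (rep b))) = m v a * m (rep a) b"
proof -
  have D: "det (rep a) (rep b) \<in> K" "det (rep a) (rep b) \<noteq> 0"
    using assms det_rep_eq_0_iff by auto
  have "\<eta> (det (rep a) v) = m v a"
    using assms det_swap[of "rep a" v] by (simp add: m_def)
  then show "\<eta> (det v (rep b) * finv (det (rep a) (rep b))) = m v b * m (rep a) b"
    "\<eta> (det (rep a) v * finv (det (rep a) (rep b))) = m v a * m (rep a) b"
    using assms D by (simp_all add: \<eta>_mult \<eta>_finv m_def)
qed

abbreviation char_line :: "'a option \<Rightarrow> 'a \<times> 'a \<Rightarrow> real" where "char_line \<equiv> supp_line \<eta>"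
abbreviation ind_line :: "'a option \<Rightarrow> 'a \<times> 'a \<Rightarrow> real" where "ind_line \<equiv> supp_line (\<lambda>_. 1)"

lemma coord_eq_0_iff:
  assumes "a \<in> points" "v \<in> line a" shows "coord a v = 0 \<longleftrightarrow> v = 0"
proof
  assume "coord a v = 0"
  then show "v = 0" using line_coord[OF assms] by (simp add: smul_def zero_prod_def)
qed (cases a; simp)

text \<open>On distinct lines the matrix entry \<open>m (rep a) b\<close> occurs twice and squares
  to 1. On equal lines the Jacobsthal sum appears; as \<open>m v a\<close> squares to 0 on the line
  and to 1 off it, both cases fit the form of a rank-one term plus a diagonal correction.\<close>

lemma conv_char_char:
  assumes "a \<in> points" "b \<in> points" "v \<in> K \<times> K"
  shows "conv (K \<times> K) (char_line a) (char_line b) v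
    = m v a * m v b + (if a = b then (if v = 0 then real (card K) else 0) - 1 else 0)"
proof (cases "a = b")
  case True
  have "v \<in> line a" if "v = 0" using that subgrp_zero[OF subgrp_line] assms by blast
  then show ?thesis unfolding True[symmetric] conv_supp_line_same[OF assms(1)]
    using conv_\<eta>_\<eta>[of "coord a v"] assms by (simp add: m_square coord_eq_0_iff)
next
  case False
  have "m v b * m (rep a) b * (m v a * m (rep a) b) = m v a * m v b * (m (rep a) b * m (rep a) b)"
    by simp
  then show ?thesis
    using False by (simp add: conv_supp_line_distinct assms cramer_coeffs m_rep_square)
qed

text \<open>On distinct lines only the second Cramer coordinate meets \<open>\<eta>\<close>; on
  equal lines both sides vanish, since \<open>\<eta>\<close> sums to zero over
  \<open>K\<close>.\<close>

lemma conv_ind_char: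
  assumes "a \<in> points" "b \<in> points" "v \<in> K \<times> K"
  shows "conv (K \<times> K) (ind_line a) (char_line b) v = m v a * m (rep a) b"
proof (cases "a = b")
  case True
  have "conv K (\<lambda>_. 1) \<eta> (coord a v) = 0"
    using sum_reflect_K[of "coord a v" \<eta>] assms by (simp add: conv_def sum_\<eta>)
  moreover have "m (rep a) a = 0" by (simp add: m_def \<eta>_0)
  ultimately show ?thesis unfolding True[symmetric] conv_supp_line_same[OF assms(1)] by simp
next
  case False
  then show ?thesis by (simp add: conv_supp_line_distinct assms cramer_coeffs)
qed

lemma conv_ind_ind:
  assumes "a \<in> points" "b \<in> points" "v \<in> K \<times> K"
  shows "conv (K \<times> K) (ind_line a) (ind_line b) v
    = 1 + (if a = b then real (card K) * (1 - m v a * m v a) - 1 else 0)"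
proof (cases "a = b")
  case True
  have "conv K (\<lambda>_. 1) (\<lambda>_. 1) (coord a v) = real (card K)" by (simp add: conv_def)
  then show ?thesis unfolding True[symmetric] conv_supp_line_same[OF assms(1)]
    using assms by (simp add: m_square)
next
  case False
  then show ?thesis by (simp add: conv_supp_line_distinct assms)
qed

section \<open>Character sums along lines of \<open>K\<close> over \<open>F\<close>, and
  eigenvectors\<close>

lemma q_pos: "q > 0" using odd_q by (cases q) auto

text \<open>As \<open>c\<close> is no \<open>F\<close>-multiple of \<open>x\<close>, the two are
  independent over \<open>F\<close>, and they form a basis because \<open>K\<close> has
  \<open>q\<^sup>2\<close> elements.\<close>

lemma bij_coords:
  assumes "c \<in> K" "x \<in> K" "x \<noteq> 0" "\<And>f. f \<in> F \<Longrightarrow> c \<noteq> x * f"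
  shows "bij_betw (\<lambda>(f, g). c * f + x * g) (F \<times> F) K"
proof -
  have fF: "finite F" using F subgrp_finite by blast
  have inj: "inj_on (\<lambda>(f, g). c * f + x * g) (F \<times> F)"
  proof (rule inj_onI, clarify)
    fix f g f' g' assume fg: "f \<in> F" "g \<in> F" "f' \<in> F" "g' \<in> F" "c * f + x * g = c * f' + x * g'"
    then have eq: "c * (f - f') = x * (g' - g)" by (simp add: algebra_simps)
    have ff: "f = f'"
    proof (rule ccontr)
      assume "f \<noteq> f'"
      then obtain y where y: "y \<in> F" "(f - f') * y = e" using F_inv[of "f - f'"] subgrp_diff[OF F] fg by auto
      have "c * ((f - f') * y) = x * ((g' - g) * y)" using eq by (metis mult.assoc)
      then have "c = x * ((g' - g) * y)" using y assms by simp
      moreover have "(g' - g) * y \<in> F" using fg y by (intro mult_F subgrp_diff[OF F])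
      ultimately show False using assms(4) by blast
    qed
    then have "x * g' = x * g" using fg by simp
    then have "g' = g" using mult_left_cancel_K[of x g' g] fg assms F_in_K by blast
    then show "f = f' \<and> g = g'" using ff by simp
  qed
  moreover have "(\<lambda>(f, g). c * f + x * g) ` (F \<times> F) = K"
  proof (rule card_subset_eq)
    show "card ((\<lambda>(f, g). c * f + x * g) ` (F \<times> F)) = card K"
      using card_image[OF inj] by (simp add: card_cartesian_product card_F card_K power2_eq_square)
  qed (use assms F_in_K in auto)
  ultimately show ?thesis by (simp add: bij_betw_def)
qed

lemma sum_F_scale:
  assumes "f \<in> F" "f \<noteq> 0" shows "(\<Sum>g\<in>F. h (f * g)) = (\<Sum>g\<in>F. h g :: real)"
proof -
  obtain y where y: "y \<in> F" "f * y = e" using F_inv assms by blast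
  have *: "y * (f * g) = g" "f * (y * g) = g" if "g \<in> F" for g
    using that y F_in_K by (simp_all flip: mult.assoc add: mult.commute[of y f])
  show ?thesis
    by (rule sum.reindex_bij_witness[of _ "\<lambda>g. y * g" "\<lambda>g. f * g"]) (use * y assms mult_F in auto)
qed

text \<open>On the line \<open>x F\<close> through 0 the character is \<open>\<eta> x\<close> except
  at 0. The parallels \<open>c f + x F\<close> with \<open>f \<noteq> 0\<close> arise from one
  another by scaling with \<open>F\<close>, which preserves \<open>\<eta>\<close>, so all have the
  same sum \<open>S\<close>. They partition the rest of \<open>K\<close>, and the total 0 equals
  \<open>(q - 1) * (\<eta> x + S)\<close>.\<close>

lemma sum_\<eta>_coset:
  assumes "c \<in> K" "x \<in> K" "x \<noteq> 0"
  shows "(\<Sum>g\<in>F. \<eta> (c + x * g)) = \<eta> x * ((if \<exists>f\<in>F. c = x * f then real q else 0) - 1)"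
proof -
  have fF: "finite F" using F subgrp_finite by blast
  have base: "(\<Sum>g\<in>F. \<eta> (x * g)) = \<eta> x * (real q - 1)"
  proof -
    have "(\<Sum>g\<in>F. \<eta> (x * g)) = (\<Sum>g\<in>F. \<eta> x * (1 - (if g = 0 then 1 else 0)))"
      using assms F_in_K \<eta>_F by (intro sum.cong) (auto simp: \<eta>_mult \<eta>_0)
    then show ?thesis using fF subgrp_zero[OF F] by (simp add: sum_subtractf card_F flip: sum_distrib_left)
  qed
  show ?thesis
  proof (cases "\<exists>f\<in>F. c = x * f")
    case True
    then obtain f where f: "f \<in> F" "c = x * f" by blast
    have "(\<Sum>g\<in>F. \<eta> (c + x * g)) = (\<Sum>g\<in>F. \<eta> (x * (f + g)))" by (simp add: f algebra_simps)
    also have "\<dots> = (\<Sum>g\<in>F. \<eta> (x * g))"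
      by (rule sum.reindex_bij_witness[of _ "\<lambda>g. g - f" "\<lambda>g. f + g"])
         (use f F in \<open>auto simp: subgrp_simps\<close>)
    finally show ?thesis using True base by simp
  next
    case False
    define S where "S = (\<Sum>g\<in>F. \<eta> (c + x * g))"
    have row: "(\<Sum>g\<in>F. \<eta> (c * f + x * g)) = S" if f: "f \<in> F" "f \<noteq> 0" for f
    proof -
      have "(\<Sum>g\<in>F. \<eta> (c * f + x * g)) = (\<Sum>g\<in>F. \<eta> (c * f + x * (f * g)))"
        by (rule sum_F_scale[OF f, of "\<lambda>g. \<eta> (c * f + x * g)", symmetric])
      also have "\<dots> = (\<Sum>g\<in>F. \<eta> (f * (c + x * g)))" by (simp add: algebra_simps)
      also have "\<dots> = S" unfolding S_def using f assms F_in_K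
        by (intro sum.cong) (auto simp: \<eta>_mult \<eta>_F)
      finally show ?thesis .
    qed
    have "0 = (\<Sum>y\<in>K. \<eta> y)" by (simp add: sum_\<eta>)
    also have "\<dots> = (\<Sum>(f, g)\<in>F \<times> F. \<eta> (c * f + x * g))"
      using sum.reindex_bij_betw[OF bij_coords[OF assms], of \<eta>] False by (simp add: case_prod_unfold)
    also have "\<dots> = (\<Sum>f\<in>F. \<Sum>g\<in>F. \<eta> (c * f + x * g))" by (simp add: sum.cartesian_product)
    also have "\<dots> = (\<Sum>g\<in>F. \<eta> (x * g)) + (\<Sum>f\<in>F - {0}. S)"
      using fF subgrp_zero[OF F] by (subst sum.remove[of _ 0]) (simp_all add: row)
    also have "\<dots> = (real q - 1) * (\<eta> x + S)"
      using fF subgrp_zero[OF F] q_pos by (simp add: base card_F of_nat_diff) (simp add: algebra_simps)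
    finally have "q = 1 \<or> S = - \<eta> x" by auto
    moreover have "q \<noteq> 1"
    proof
      assume "q = 1"
      then obtain z where "K = {z}" using card_K by (auto simp: card_1_singleton_iff)
      then have "0 \<in> {z}" "e \<in> {z}" using subgrp_zero[OF K] eK by metis+
      then show False using e_nz by simp
    qed
    ultimately show ?thesis using False by (simp add: S_def)
  qed
qed

text \<open>\<open>m (rep p) b\<close> is the Paley conference matrix on the projective line, and \<open>per\<close> says that \<open>g\<close> is constant
  on the lines of the affine plane \<open>K = F\<^sup>2\<close> parallel to \<open>x F\<close>.\<close>
lemma conference_eigenvector:
  assumes x: "x \<in> K" "x \<noteq> 0"
    and per: "\<And>y f. y \<in> K \<Longrightarrow> f \<in> F \<Longrightarrow> g (y + x * f) = g y"
    and sum: "(\<Sum>y\<in>K. g y) = real q * \<eta> x"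
    and p: "p \<in> points"
  shows "(\<Sum>b\<in>points. m (rep p) b * case_option 1 g b) = real q * \<eta> x * case_option 1 g p"
proof (cases p)
  \<comment> \<open>At infinity the eigenvalue equation is just the prescribed sum of
    \<open>g\<close>.\<close>
  case None
  have "m (0, e) None = 0" by (simp add: m_def det_def \<eta>_0)
  moreover have "m (0, e) (Some b) = 1" if "b \<in> K" for b
    using that by (simp add: m_def det_def)
  ultimately show ?thesis using None sum by (simp add: sum_points)
next
  case (Some a)
  then have a: "a \<in> K" using p by (auto simp: points_def)
  have fF: "finite F" using F subgrp_finite by blast
  have "m (e, a) None = 1" by (simp add: m_def det_def)
  moreover have "m (e, a) (Some b) = \<eta> (b - a)" if "b \<in> K" for b
    using that a by (simp add: m_def det_def)
  ultimately have "(\<Sum>b\<in>points. m (rep p) b * case_option 1 g b) = 1 + (\<Sum>b\<in>K. \<eta> (b - a) * g b)"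
    using Some by (simp add: sum_points)
  also have "(\<Sum>b\<in>K. \<eta> (b - a) * g b) = (\<Sum>c\<in>K. \<eta> c * g (a + c))"
    by (rule sum.reindex_bij_witness[of _ "\<lambda>c. a + c" "\<lambda>b. b - a"]) (use a in auto)
  finally have lhs: "(\<Sum>b\<in>points. m (rep p) b * case_option 1 g b) = 1 + (\<Sum>c\<in>K. \<eta> c * g (a + c))" .
  \<comment> \<open>Shifting \<open>c\<close> by \<open>x f\<close> leaves \<open>g\<close>
    unchanged, so averaging over \<open>f \<in> F\<close> replaces \<open>\<eta> c\<close> by its
    sum over a line parallel to \<open>x F\<close>. These sums are constant apart from the line
    through 0, which contributes \<open>q\<close> times \<open>g a\<close>.\<close>
  have "real q * (\<Sum>c\<in>K. \<eta> c * g (a + c)) = (\<Sum>f\<in>F. \<Sum>c\<in>K. \<eta> (c + x * f) * g (a + c))"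
  proof -
    have "(\<Sum>c\<in>K. \<eta> c * g (a + c)) = (\<Sum>c\<in>K. \<eta> (c + x * f) * g (a + c))" if f: "f \<in> F" for f
    proof -
      have "(\<Sum>c\<in>K. \<eta> c * g (a + c)) = (\<Sum>c\<in>K. \<eta> (c + x * f) * g (a + (c + x * f)))"
        using sum_shift_K[of "x * f" "\<lambda>c. \<eta> c * g (a + c)"] f x F_in_K by simp
      also have "\<dots> = (\<Sum>c\<in>K. \<eta> (c + x * f) * g (a + c))"
        using per f a by (intro sum.cong) (simp_all flip: add.assoc)
      finally show ?thesis .
    qed
    then have "(\<Sum>f\<in>F. \<Sum>c\<in>K. \<eta> (c + x * f) * g (a + c)) = (\<Sum>f\<in>F. \<Sum>c\<in>K. \<eta> c * g (a + c))"
      by simp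
    then show ?thesis by (simp add: card_F)
  qed
  also have "\<dots> = (\<Sum>c\<in>K. (\<Sum>f\<in>F. \<eta> (c + x * f)) * g (a + c))"
    unfolding sum_distrib_right by (rule sum.swap)
  also have "\<dots> = (\<Sum>c\<in>K. \<eta> x * real q * (if \<exists>f\<in>F. c = x * f then g (a + c) else 0) - \<eta> x * g (a + c))"
    using x by (intro sum.cong refl, subst sum_\<eta>_coset) (simp_all add: left_diff_distrib right_diff_distrib)
  also have "\<dots> = \<eta> x * real q * (\<Sum>c\<in>K. if \<exists>f\<in>F. c = x * f then g (a + c) else 0) - \<eta> x * (\<Sum>c\<in>K. g (a + c))"
    by (simp add: sum_subtractf flip: sum_distrib_left)
  also have "(\<Sum>c\<in>K. g (a + c)) = real q * \<eta> x"
    using sum_shift_K[of a g] a sum by (simp add: add.commute)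
  also have "(\<Sum>c\<in>K. if \<exists>f\<in>F. c = x * f then g (a + c) else 0) = (\<Sum>c\<in>(\<lambda>f. x * f) ` F. g (a + c))"
    using x F_in_K by (subst sum.inter_filter[symmetric]) (auto intro!: sum.cong)
  also have "\<dots> = (\<Sum>f\<in>F. g (a + x * f))"
    by (subst sum.reindex) (use x F_in_K mult_left_cancel_K in \<open>auto simp: inj_on_def\<close>)
  also have "\<dots> = real q * g a" using per a by (simp add: card_F)
  finally have "real q * (1 + (\<Sum>c\<in>K. \<eta> c * g (a + c))) = real q * (real q * \<eta> x * g a)"
    using \<eta>_square[OF x(1)] x(2) by (simp add: algebra_simps)
  then have "1 + (\<Sum>c\<in>K. \<eta> c * g (a + c)) = real q * \<eta> x * g a" using q_pos by simp
  then show ?thesis using lhs Some by simp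
qed

end

section \<open>Turyn functions on a plane of odd square order\<close>

lemma conv_double_sum:
  "conv H (\<lambda>v. \<Sum>a\<in>I. w a * \<alpha> a v) (\<lambda>v. \<Sum>b\<in>J. t b * \<beta> b v) v
   = (\<Sum>a\<in>I. \<Sum>b\<in>J. w a * t b * conv H (\<alpha> a) (\<beta> b) v)"
  unfolding conv_sum_left conv_sum_right conv_scale_left conv_scale_right
  by (simp add: sum_distrib_left mult.assoc)

text \<open>A quadratic form with matrix of rank one plus diagonal, the shape in which convolutions
  of lines occur.\<close>

lemma double_sum_diagonal:
  fixes w :: "'i \<Rightarrow> real"
  assumes "finite I"
  shows "(\<Sum>a\<in>I. \<Sum>b\<in>I. w a * w b * (x a * x b + (if a = b then y a else 0)))
    = (\<Sum>a\<in>I. w a * x a)\<^sup>2 + (\<Sum>a\<in>I. w a * w a * y a)"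
proof -
  have "(\<Sum>b\<in>I. w a * w b * (x a * x b + (if a = b then y a else 0)))
      = (\<Sum>b\<in>I. (w a * x a) * (w b * x b)) + w a * w a * y a" if "a \<in> I" for a
  proof -
    have "(\<Sum>b\<in>I. w a * w b * (x a * x b + (if a = b then y a else 0)))
      = (\<Sum>b\<in>I. (w a * x a) * (w b * x b) + (if b = a then w a * w a * y a else 0))"
      by (intro sum.cong) (auto simp: algebra_simps)
    then show ?thesis using assms that by (simp add: sum.distrib)
  qed
  then show ?thesis by (simp add: sum.distrib power2_eq_square sum_product)
qed

lemma even_sign_disjoint_supports:
  assumes "\<And>v. v \<in> H \<Longrightarrow> B v = 0 \<and> (A v = 1 \<or> A v = -1) \<or> A v = 0 \<and> (B v = 1 \<or> B v = -1)"
    and "\<And>v. v \<in> H \<Longrightarrow> A (- v) = A v" "\<And>v. v \<in> H \<Longrightarrow> B (- v) = B v"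
  shows "even_sign H (\<lambda>v. A v + B v)" "even_sign H (\<lambda>v. A v - B v)"
  unfolding even_sign_def
proof (safe del: disjCI)
  fix v assume v: "v \<in> H"
  show "A v + B v = 1 \<or> A v + B v = -1" "A v - B v = 1 \<or> A v - B v = -1"
    using assms(1)[OF v] by auto
  show "A (- v) + B (- v) = A v + B v" "A (- v) - B (- v) = A v - B v"
    using assms(2,3)[OF v] by simp_all
qed

context quadratic_field_set
begin

text \<open>Two sign eigenvectors \<open>h1\<close>, \<open>h2\<close> with eigenvalues
  \<open>q\<close> and \<open>- q\<close> are built from the coordinates with respect to
  \<open>e, d\<close>. The matrix then exchanges their half sum and half difference up to the factor
  \<open>q\<close>.\<close>

lemma ex_conference_pair:
  obtains s t :: "'a option \<Rightarrow> real" where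
    "\<And>p. p \<in> points \<Longrightarrow> s p = 0 \<and> (t p = 1 \<or> t p = -1) \<or> t p = 0 \<and> (s p = 1 \<or> s p = -1)"
    "\<And>p. p \<in> points \<Longrightarrow> (\<Sum>b\<in>points. m (rep p) b * s b) = real q * t p"
    "\<And>p. p \<in> points \<Longrightarrow> (\<Sum>b\<in>points. m (rep p) b * t b) = real q * s p"
    "2 * (\<Sum>p\<in>points. s p * s p) = real (card K) + 1"
    "2 * (\<Sum>p\<in>points. t p * t p) = real (card K) + 1"
proof -
  obtain \<gamma> :: "'a \<Rightarrow> real" where \<gamma>: "\<And>f. f \<in> F \<Longrightarrow> \<gamma> f = 1 \<or> \<gamma> f = -1" "sum \<gamma> F = 1"
    using odd_card_sign_sum_one[of F] card_F odd_q by blast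
  have "e \<noteq> d * f" if "f \<in> F" for f
  proof
    assume "e = d * f"
    then have "\<eta> e = - \<eta> f" using \<eta>_mult dK F_in_K[OF that] \<eta>_d by simp
    then show False using \<eta>_F[OF that] \<eta>_0 by (cases "f = 0") auto
  qed
  from bij_coords[OF eK dK d_nz this]
  have bij: "bij_betw (\<lambda>(f, g). e * f + d * g) (F \<times> F) K" .
  define \<psi> where "\<psi> = inv_into (F \<times> F) (\<lambda>(f, g). e * f + d * g)"
  have \<psi>: "\<psi> (f + d * g) = (f, g)" if "f \<in> F" "g \<in> F" for f g
    using inv_into_f_f[OF bij_betw_imp_inj_on[OF bij], of "(f, g)"] that F_in_K by (simp add: \<psi>_def)
  have coords: "\<exists>f\<in>F. \<exists>g\<in>F. y = f + d * g" if "y \<in> K" for y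
  proof -
    have "y \<in> (\<lambda>(f, g). e * f + d * g) ` (F \<times> F)" using bij that by (simp add: bij_betw_def)
    then show ?thesis using F_in_K by force
  qed
  have sumK: "(\<Sum>y\<in>K. h y) = (\<Sum>f\<in>F. \<Sum>g\<in>F. h (f + d * g) :: real)" for h
    
    unfolding sum.reindex_bij_betw[OF bij, of h, symmetric] sum.cartesian_product
    using F_in_K by (intro sum.cong) auto
  \<comment> \<open>\<open>g1\<close> depends only on the \<open>d\<close>-coordinate and
    \<open>g2\<close> only on the \<open>e\<close>-coordinate, so they are constant along
    \<open>e F\<close> and \<open>d F\<close>. The minus sign in \<open>g2\<close> makes its sum
    \<open>- q\<close>, that is \<open>q * \<eta> d\<close>, as an eigenvector in that direction
    requires.\<close>
  define g1 where "g1 y = \<gamma> (snd (\<psi> y))" for y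
  define g2 where "g2 y = - \<gamma> (fst (\<psi> y))" for y
  have g: "g1 (f + d * g) = \<gamma> g" "g2 (f + d * g) = - \<gamma> f" if "f \<in> F" "g \<in> F" for f g
    using \<psi>[OF that] by (simp_all add: g1_def g2_def)
  have per1: "g1 (y + e * f') = g1 y" if y: "y \<in> K" "f' \<in> F" for y f'
  proof -
    obtain f g' where f: "f \<in> F" "g' \<in> F" "y = f + d * g'" using coords y by blast
    have eq: "y + e * f' = (f + f') + d * g'" using f y F_in_K by (simp add: algebra_simps)
    show ?thesis unfolding eq unfolding f(3) using f(1,2) y(2) by (simp add: g subgrp_add[OF F])
  qed
  have per2: "g2 (y + d * f') = g2 y" if y: "y \<in> K" "f' \<in> F" for y f'
  proof -
    obtain f g' where f: "f \<in> F" "g' \<in> F" "y = f + d * g'" using coords y by blast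
    have eq: "y + d * f' = f + d * (g' + f')" using f by (simp add: algebra_simps)
    show ?thesis unfolding eq unfolding f(3) using f(1,2) y(2) by (simp add: g subgrp_add[OF F])
  qed
  have sums: "(\<Sum>y\<in>K. g1 y) = real q * \<eta> e" "(\<Sum>y\<in>K. g2 y) = real q * \<eta> d" "(\<Sum>y\<in>K. g1 y * g2 y) = -1"
    using \<gamma>(2) unfolding sumK
    by (simp_all add: g card_F \<eta>_d sum_negf flip: sum_distrib_left sum_distrib_right)
  have sgn: "g1 y = 1 \<or> g1 y = -1" "g2 y = 1 \<or> g2 y = -1" if "y \<in> K" for y
    using coords[OF that] \<gamma>(1) g by force+
  define h1 h2 :: "'a option \<Rightarrow> real" where "h1 = case_option 1 g1" and "h2 = case_option 1 g2"
  have E1: "(\<Sum>b\<in>points. m (rep p) b * h1 b) = real q * h1 p" if "p \<in> points" for p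
    using conference_eigenvector[OF eK e_nz per1 sums(1) that] by (simp add: h1_def)
  have E2: "(\<Sum>b\<in>points. m (rep p) b * h2 b) = - real q * h2 p" if "p \<in> points" for p
    using conference_eigenvector[OF dK d_nz per2 sums(2) that] by (simp add: h2_def \<eta>_d)
  have hs: "h1 p = 1 \<or> h1 p = -1" "h2 p = 1 \<or> h2 p = -1" if "p \<in> points" for p
    by (cases p; use that sgn[of "the p"] in \<open>auto simp: points_def h1_def h2_def\<close>)+
  \<comment> \<open>Over \<open>K\<close> the products sum to -1, and the point at infinity
    contributes 1. This orthogonality gives the half sum and the half difference supports of equal
    size.\<close>
  have h0: "(\<Sum>p\<in>points. h1 p * h2 p) = 0"
    using sums(3) by (simp add: sum_points h1_def h2_def)
  define s where "s p = (h1 p + h2 p) / 2" for p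
  define t where "t p = (h1 p - h2 p) / 2" for p
  have "2 * (\<Sum>p\<in>points. s p * s p) = (\<Sum>p\<in>points. 1 + h1 p * h2 p)"
    "2 * (\<Sum>p\<in>points. t p * t p) = (\<Sum>p\<in>points. 1 - h1 p * h2 p)"
    unfolding sum_distrib_left using hs by (force intro!: sum.cong simp: s_def t_def)+
  then have "2 * (\<Sum>p\<in>points. s p * s p) = real (card K) + 1"
    "2 * (\<Sum>p\<in>points. t p * t p) = real (card K) + 1"
    by (simp_all add: sum.distrib sum_subtractf h0 card_points)
  moreover have "(\<Sum>b\<in>points. m (rep p) b * s b) = real q * t p"
    "(\<Sum>b\<in>points. m (rep p) b * t b) = real q * s p" if "p \<in> points" for p
    using E1[OF that] E2[OF that]
    by (simp_all add: s_def t_def ring_distribs sum.distrib sum_subtractf add_divide_distrib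
        diff_divide_distrib flip: sum_divide_distrib)
  moreover have "s p = 0 \<and> (t p = 1 \<or> t p = -1) \<or> t p = 0 \<and> (s p = 1 \<or> s p = -1)"
    if "p \<in> points" for p
    using hs[OF that] by (auto simp: s_def t_def)
  ultimately show thesis using that by blast
qed

text \<open>At a nonzero point of line \<open>c\<close>, with \<open>n\<close> the order of
  \<open>K\<close>, the square of \<open>W\<close> is
  \<open>1 + n * (t c * t c) - (n + 1) / 2\<close>. That of \<open>Z\<close> is
  \<open>n * (s c * s c) - (n + 1) / 2\<close>, because the rank-one part is the square of a matrix
  row applied to \<open>t\<close>, which is \<open>q * s c\<close> up to sign. The total vanishes
  since \<open>s\<close>, \<open>t\<close> have complementary supports. The product of
  \<open>W\<close> and \<open>Z\<close> again meets the matrix applied to \<open>t\<close>, giving a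
  factor \<open>w a * s a = 0\<close>.\<close>

lemma conv_spread_char:
  fixes s t w :: "'a option \<Rightarrow> real"
  defines "W \<equiv> \<lambda>v. \<Sum>a\<in>points. w a * ind_line a v"
    and "Z \<equiv> \<lambda>v. \<Sum>a\<in>points. t a * char_line a v"
  assumes st: "\<And>p. p \<in> points \<Longrightarrow> s p * s p + t p * t p = 1"
    and disj: "\<And>p. p \<in> points \<Longrightarrow> w p * s p = 0"
    and Mt: "\<And>p. p \<in> points \<Longrightarrow> (\<Sum>b\<in>points. m (rep p) b * t b) = real q * s p"
    and sum_t: "2 * (\<Sum>p\<in>points. t p * t p) = real (card K) + 1"
    and w: "\<And>p. p \<in> points \<Longrightarrow> w p * w p = t p * t p" "sum w points = 1"
    and v: "v \<in> K \<times> K"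
  shows "conv (K \<times> K) W W v + conv (K \<times> K) Z Z v = (if v = 0 then real ((card K)\<^sup>2) else 0)"
    and "conv (K \<times> K) W Z v = 0"
proof -
  define n where "n = real (card K)"
  have sum_ww: "(\<Sum>a\<in>points. w a * w a) = (n + 1) / 2"
    using sum_t w(1) by (simp add: n_def)
  have WW: "conv (K \<times> K) W W v = 1 + (\<Sum>a\<in>points. w a * w a * (n * (1 - m v a * m v a) - 1))"
  proof -
    have "conv (K \<times> K) W W v = (\<Sum>a\<in>points. \<Sum>b\<in>points. w a * w b * (1 * 1 +
        (if a = b then n * (1 - m v a * m v a) - 1 else 0)))"
      unfolding W_def conv_double_sum n_def by (intro sum.cong refl) (simp add: conv_ind_ind v)
    also have "\<dots> = (\<Sum>a\<in>points. w a * 1)\<^sup>2 + (\<Sum>a\<in>points. w a * w a * (n * (1 - m v a * m v a) - 1))"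
      by (rule double_sum_diagonal) simp
    finally show ?thesis using w(2) by simp
  qed
  have ZZ: "conv (K \<times> K) Z Z v = (\<Sum>a\<in>points. t a * m v a)\<^sup>2
      + (\<Sum>a\<in>points. t a * t a * ((if v = 0 then n else 0) - 1))"
  proof -
    have "conv (K \<times> K) Z Z v = (\<Sum>a\<in>points. \<Sum>b\<in>points. t a * t b * (m v a * m v b +
        (if a = b then (if v = 0 then n else 0) - 1 else 0)))"
      unfolding Z_def conv_double_sum n_def by (intro sum.cong refl) (simp add: conv_char_char v)
    also have "\<dots> = (\<Sum>a\<in>points. t a * m v a)\<^sup>2
        + (\<Sum>a\<in>points. t a * t a * ((if v = 0 then n else 0) - 1))"
      by (rule double_sum_diagonal) simp
    finally show ?thesis .
  qed
  have sum_tt: "(\<Sum>a\<in>points. t a * t a) = (n + 1) / 2" using sum_t by (simp add: n_def)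
  show "conv (K \<times> K) W W v + conv (K \<times> K) Z Z v = (if v = 0 then real ((card K)\<^sup>2) else 0)"
  proof (cases "v = 0")
    case True
    have "conv (K \<times> K) W W v + conv (K \<times> K) Z Z v = 1 + (n + 1) / 2 * (n - 1) + (n + 1) / 2 * (n - 1)"
      unfolding WW ZZ unfolding True m_zero by (simp add: sum_ww sum_tt flip: sum_distrib_right)
    then show ?thesis using True by (simp add: n_def field_simps power2_eq_square)
  next
    case False
    then obtain c l where c: "c \<in> points" "l \<in> K" "l \<noteq> 0" "v = smul l (rep c)"
      using nonzero_vector v by metis
    have mm: "m v a = \<eta> l * m (rep c) a" if "a \<in> points" for a
      unfolding c(4) using c that by (simp add: m_smul)
    have ll: "\<eta> l * \<eta> l = 1" using \<eta>_square c by simp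
    have "m v a * m v a = (if a = c then 0 else 1)" if "a \<in> points" for a
    proof -
      have "m v a * m v a = (\<eta> l * \<eta> l) * (m (rep c) a * m (rep c) a)" unfolding mm[OF that] by simp
      then show ?thesis using ll m_rep_square[OF c(1) that] by auto
    qed
    then have "(\<Sum>a\<in>points. w a * w a * (n * (1 - m v a * m v a) - 1)) =
       (\<Sum>a\<in>points. (if a = c then n * (w a * w a) else 0) - w a * w a)"
      by (intro sum.cong) (auto simp: algebra_simps)
    also have "\<dots> = n * (t c * t c) - (n + 1) / 2"
      using c(1) w(1) sum_ww by (simp add: sum_subtractf)
    finally have 1: "conv (K \<times> K) W W v = 1 + (n * (t c * t c) - (n + 1) / 2)" using WW by simp
    have "(\<Sum>a\<in>points. t a * m v a) = \<eta> l * (\<Sum>a\<in>points. m (rep c) a * t a)"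
      unfolding sum_distrib_left by (intro sum.cong) (simp_all add: mm mult_ac)
    also have "\<dots> = \<eta> l * (real q * s c)" using Mt c(1) by simp
    finally have "(\<Sum>a\<in>points. t a * m v a)\<^sup>2 = (\<eta> l * \<eta> l) * (real (q\<^sup>2) * (s c * s c))"
      by (simp add: power2_eq_square mult_ac)
    then have "conv (K \<times> K) Z Z v = n * (s c * s c) - (n + 1) / 2"
      unfolding ZZ using False by (simp add: ll n_def card_K sum_negf) (simp add: sum_tt n_def card_K)
    moreover have "n * (t c * t c) + n * (s c * s c) = n" using st[OF c(1)]
      by (simp add: add.commute flip: distrib_left)
    ultimately show ?thesis using 1 False by (simp add: field_simps)
  qed
  have "conv (K \<times> K) W Z v = (\<Sum>a\<in>points. w a * m v a * (\<Sum>b\<in>points. m (rep a) b * t b))"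
    unfolding W_def Z_def conv_double_sum sum_distrib_left
    by (intro sum.cong refl) (simp add: conv_ind_char v mult_ac)
  also have "\<dots> = (\<Sum>a\<in>points. (w a * s a) * (m v a * real q))"
    by (intro sum.cong refl) (simp add: Mt)
  also have "\<dots> = 0" by (simp add: disj)
  finally show "conv (K \<times> K) W Z v = 0" .
qed

text \<open>\<open>W\<close> and \<open>Y\<close> are signed sums of the lines in the supports of
  \<open>t\<close> and \<open>s\<close>, while \<open>X\<close> and \<open>Z\<close> spread
  \<open>s\<close> and \<open>t\<close> by the character. Thus \<open>W, X\<close> have
  complementary supports, and so have \<open>Y, Z\<close>; the convolution identities pair
  \<open>W\<close> with \<open>Z\<close> and \<open>Y\<close> with \<open>X\<close>.\<close>

theorem turyn_group_plane: "turyn_group (K \<times> K) (card K)"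
proof -
  obtain s t :: "'a option \<Rightarrow> real" where
    st: "\<And>p. p \<in> points \<Longrightarrow> s p = 0 \<and> (t p = 1 \<or> t p = -1) \<or> t p = 0 \<and> (s p = 1 \<or> s p = -1)"
    and Ms: "\<And>p. p \<in> points \<Longrightarrow> (\<Sum>b\<in>points. m (rep p) b * s b) = real q * t p"
    and Mt: "\<And>p. p \<in> points \<Longrightarrow> (\<Sum>b\<in>points. m (rep p) b * t b) = real q * s p"
    and ss: "2 * (\<Sum>p\<in>points. s p * s p) = real (card K) + 1"
    and tt: "2 * (\<Sum>p\<in>points. t p * t p) = real (card K) + 1"
  proof (rule ex_conference_pair, goal_cases)
    case (1 s t)
    show ?case by (rule that[OF 1(2-6)])
  qed
  \<comment> \<open>The support has \<open>(q\<^sup>2 + 1) / 2\<close> points, an odd number for odd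
    \<open>q\<close>, so signs on it can be chosen with sum 1.\<close>
  have ex: "\<exists>w :: 'a option \<Rightarrow> real. (\<forall>p\<in>points. r p = 0 \<and> w p = 0 \<or> r p \<noteq> 0 \<and> (w p = 1 \<or> w p = -1))
      \<and> sum w points = 1"
    if r: "\<And>p. p \<in> points \<Longrightarrow> r p = 0 \<or> r p = 1 \<or> r p = -1"
      and rr: "2 * (\<Sum>p\<in>points. r p * r p) = real (card K) + 1" for r :: "'a option \<Rightarrow> real"
  proof -
    let ?S = "{p\<in>points. r p \<noteq> 0}"
    have "(\<Sum>p\<in>points. r p * r p) = (\<Sum>p\<in>?S. 1)"
      by (subst sum.inter_filter) (use r in \<open>force intro!: sum.cong\<close>)+
    then have "real (2 * card ?S) = real (card K + 1)" using rr by simp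
    then have c: "2 * card ?S = q\<^sup>2 + 1" by (simp only: of_nat_eq_iff card_K)
    obtain j where "q = 2 * j + 1" using odd_q by (elim oddE)
    then have "card ?S = 2 * (j * j + j) + 1" using c by (simp add: power2_eq_square algebra_simps)
    then have "odd (card ?S)" by simp
    then obtain w :: "'a option \<Rightarrow> real" where w: "\<And>p. p \<in> ?S \<Longrightarrow> w p = 1 \<or> w p = -1" "sum w ?S = 1"
      using odd_card_sign_sum_one[of ?S] by blast
    let ?w = "\<lambda>p. if r p \<noteq> 0 then w p else 0"
    have "sum ?w points = 1" using w(2) by (simp add: sum.inter_filter)
    then show ?thesis using w(1) by (intro exI[of _ ?w]) auto
  qed
  have tr: "t p = 0 \<or> t p = 1 \<or> t p = -1" "s p = 0 \<or> s p = 1 \<or> s p = -1"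
    if "p \<in> points" for p using st[OF that] by auto
  obtain w :: "'a option \<Rightarrow> real" where
    w: "\<And>p. p \<in> points \<Longrightarrow> t p = 0 \<and> w p = 0 \<or> t p \<noteq> 0 \<and> (w p = 1 \<or> w p = -1)" "sum w points = 1"
    using ex[OF tr(1) tt] by blast
  obtain y :: "'a option \<Rightarrow> real" where
    y: "\<And>p. p \<in> points \<Longrightarrow> s p = 0 \<and> y p = 0 \<or> s p \<noteq> 0 \<and> (y p = 1 \<or> y p = -1)" "sum y points = 1"
    using ex[OF tr(2) ss] by blast
  define W where "W = (\<lambda>v. \<Sum>a\<in>points. w a * ind_line a v)"
  define X where "X = (\<lambda>v. \<Sum>a\<in>points. s a * char_line a v)"
  define Y where "Y = (\<lambda>v. \<Sum>a\<in>points. y a * ind_line a v)"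
  define Z where "Z = (\<lambda>v. \<Sum>a\<in>points. t a * char_line a v)"
  have sq: "s p * s p + t p * t p = 1" "t p * t p + s p * s p = 1" if "p \<in> points" for p
    using st[OF that] by auto
  have d: "w p * s p = 0" "y p * t p = 0" if "p \<in> points" for p
    using st[OF that] w(1)[OF that] y(1)[OF that] by auto
  have wy: "w p * w p = t p * t p" "y p * y p = s p * s p" if "p \<in> points" for p
    using st[OF that] w(1)[OF that] y(1)[OF that] by auto
  have WZ: "conv (K \<times> K) W W v + conv (K \<times> K) Z Z v = (if v = 0 then real ((card K)\<^sup>2) else 0)"
    "conv (K \<times> K) W Z v = 0" if "v \<in> K \<times> K" for v
    unfolding W_def Z_def
    by (rule conv_spread_char[where s = s, OF sq(1) d(1) Mt tt wy(1) w(2) that]; assumption)+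
  have XY: "conv (K \<times> K) Y Y v + conv (K \<times> K) X X v = (if v = 0 then real ((card K)\<^sup>2) else 0)"
    "conv (K \<times> K) Y X v = 0" if "v \<in> K \<times> K" for v
    unfolding X_def Y_def
    by (rule conv_spread_char[where s = t, OF sq(2) d(2) Ms ss wy(2) y(2) that]; assumption)+
  have even: "W (- v) = W v" "X (- v) = X v" "Y (- v) = Y v" "Z (- v) = Z v" if "v \<in> K \<times> K" for v
    using that by (simp_all add: W_def X_def Y_def Z_def supp_line_minus)
  have vals: "X v = 0 \<and> (W v = 1 \<or> W v = -1) \<or> W v = 0 \<and> (X v = 1 \<or> X v = -1)"
    "Z v = 0 \<and> (Y v = 1 \<or> Y v = -1) \<or> Y v = 0 \<and> (Z v = 1 \<or> Z v = -1)" if v: "v \<in> K \<times> K" for v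
  proof -
    have "(X v = 0 \<and> (W v = 1 \<or> W v = -1) \<or> W v = 0 \<and> (X v = 1 \<or> X v = -1)) \<and>
      (Z v = 0 \<and> (Y v = 1 \<or> Y v = -1) \<or> Y v = 0 \<and> (Z v = 1 \<or> Z v = -1))"
    proof (cases "v = 0")
      \<comment> \<open>All lines pass through the origin: there the signed sums of lines take the
        value 1, the sum of their signs, and the character sums vanish with
        \<open>\<eta> 0\<close>.\<close>
      case True
      have "supp_line \<alpha> a v = \<alpha> 0" if "a \<in> points" for a \<alpha>
        using that subgrp_zero[OF subgrp_line] True coord_eq_0_iff[of a v] by (simp add: supp_line_def)
      then have "W v = 1" "Y v = 1" "X v = 0" "Z v = 0"
        using w(2) y(2) by (simp_all add: W_def X_def Y_def Z_def \<eta>_0)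
      then show ?thesis by simp
    next
      case False
      then obtain c l where c: "c \<in> points" "l \<in> K" "l \<noteq> 0" "v = smul l (rep c)"
        using nonzero_vector v by metis
      have "W v = w c" "Y v = y c" "X v = s c * \<eta> l" "Z v = t c * \<eta> l"
        unfolding c(4) W_def X_def Y_def Z_def using c(1-3)
        by (simp_all add: supp_line_smul_rep if_distrib cong: if_cong)
      then show ?thesis using st[OF c(1)] w(1)[OF c(1)] y(1)[OF c(1)] \<eta>_sign[OF c(2,3)] by auto
    qed
    then show "X v = 0 \<and> (W v = 1 \<or> W v = -1) \<or> W v = 0 \<and> (X v = 1 \<or> X v = -1)"
      "Z v = 0 \<and> (Y v = 1 \<or> Y v = -1) \<or> Y v = 0 \<and> (Z v = 1 \<or> Z v = -1)" by blast+
  qed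
  \<comment> \<open>With \<open>Z\<close> ahead of \<open>Y\<close>, the first mixed relation
    compares the squares of \<open>W, Z\<close> with those of \<open>X, Y\<close>, and the other two
    contain only the products of \<open>W, Z\<close> and of \<open>Y, X\<close>.\<close>
  let ?f0 = "\<lambda>v. W v + X v" and ?f1 = "\<lambda>v. W v - X v" and ?f2 = "\<lambda>v. Z v + Y v" and ?f3 = "\<lambda>v. Z v - Y v"
  have sgn: "even_sign (K \<times> K) ?f0" "even_sign (K \<times> K) ?f1" "even_sign (K \<times> K) ?f2" "even_sign (K \<times> K) ?f3"
    by (rule even_sign_disjoint_supports; use vals even in blast)+
  have rel: "conv (K \<times> K) ?f0 ?f0 v + conv (K \<times> K) ?f1 ?f1 v + conv (K \<times> K) ?f2 ?f2 v + conv (K \<times> K) ?f3 ?f3 v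
       = (if v = 0 then 4 * real ((card K)\<^sup>2) else 0) \<and>
     conv (K \<times> K) ?f0 ?f1 v + conv (K \<times> K) ?f2 ?f3 v = 0 \<and>
     conv (K \<times> K) ?f0 ?f2 v + conv (K \<times> K) ?f1 ?f3 v = 0 \<and>
     conv (K \<times> K) ?f0 ?f3 v + conv (K \<times> K) ?f1 ?f2 v = 0" if v: "v \<in> K \<times> K" for v
  proof -
    have c: "conv (K \<times> K) X W v = conv (K \<times> K) W X v" "conv (K \<times> K) Y Z v = conv (K \<times> K) Z Y v"
      "conv (K \<times> K) X Y v = conv (K \<times> K) Y X v"
      by (rule conv_commute[OF subgrp_plane v])+
    show ?thesis unfolding conv_add_left conv_add_right conv_diff_left conv_diff_right c
      using WZ[OF v] XY[OF v] by (cases "v = 0") simp_all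
  qed
  have "card (K \<times> K) = (card K)\<^sup>2" by (simp add: card_cartesian_product power2_eq_square)
  then show ?thesis unfolding turyn_group_def using subgrp_plane sgn rel by blast
qed

end

section \<open>A ring type containing all fields of prime square order\<close>

lemma Legendre_cong:
  assumes "[a = b] (mod p)" shows "Legendre a p = Legendre b p"
  using assms by (simp add: Legendre_def QuadRes_def cong_def)

lemma Legendre_values: "Legendre a p = 0 \<or> Legendre a p = 1 \<or> Legendre a p = -1"
  by (simp add: Legendre_def)

text \<open>By Euler's criterion both sides agree modulo \<open>p\<close>; they lie in {-1, 0, 1},
  so they differ by at most 2, which is less than \<open>p\<close>.\<close>

lemma Legendre_mult:
  fixes p :: nat
  assumes "prime p" "p > 2"
  shows "Legendre (a * b) (int p) = Legendre a (int p) * Legendre b (int p)"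
proof -
  have "[Legendre (a * b) p = Legendre a p * Legendre b p] (mod int p)"
    using cong_trans[OF euler_criterion[OF assms, of "a * b", unfolded power_mult_distrib]
        cong_sym[OF cong_mult[OF euler_criterion[OF assms, of a] euler_criterion[OF assms, of b]]]] .
  then have "int p dvd Legendre (a * b) p - Legendre a p * Legendre b p"
    by (simp add: cong_iff_dvd_diff)
  moreover have "\<bar>Legendre (a * b) p - Legendre a p * Legendre b p\<bar> < int p"
    using Legendre_values[of "a * b" p] Legendre_values[of a p] Legendre_values[of b p] assms(2)
    by (elim disjE) simp_all
  ultimately show ?thesis using zdvd_not_zless[of "\<bar>Legendre (a * b) p - Legendre a p * Legendre b p\<bar>" p]
    by (metis dvd_abs_iff eq_iff_diff_eq_0 zero_less_abs_iff)
qed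

text \<open>Squaring modulo \<open>p\<close> identifies 1 and \<open>p - 1\<close>, so it is not
  injective, hence not surjective on a finite set.\<close>

lemma ex_not_QuadRes:
  assumes "odd (p::nat)" "p > 2" shows "\<exists>n. \<not> QuadRes (int p) n"
proof (rule ccontr)
  assume "\<not> ?thesis"
  then have all: "\<exists>y. [y^2 = n] (mod int p)" for n by (simp add: QuadRes_def)
  let ?S = "{0..<int p}" and ?f = "\<lambda>x. x^2 mod int p"
  have "?S \<subseteq> ?f ` ?S"
  proof
    fix n assume n: "n \<in> ?S"
    obtain y where "[y^2 = n] (mod int p)" using all by blast
    then have "?f (y mod int p) = n" using n by (simp add: cong_def power_mod)
    moreover have "y mod int p \<in> ?S" using assms by simp
    ultimately show "n \<in> ?f ` ?S" by blast
  qed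
  then have inj: "inj_on ?f ?S" using finite_surj_inj by blast
  have eq: "?f (int p - 1) = ?f 1"
  proof -
    have "(int p - 1)^2 - 1^2 = int p * (int p - 2)" by (simp add: power2_eq_square algebra_simps)
    then show ?thesis by (metis dvd_triv_left mod_eq_dvd_iff)
  qed
  have "int p - 1 = 1" using assms(2) by (intro inj_onD[OF inj eq]) auto
  then show False using assms by simp
qed

definition nonres :: "nat \<Rightarrow> int" where "nonres p = (SOME n. \<not> QuadRes (int p) n)"

lemma nonres: "odd p \<Longrightarrow> p > 2 \<Longrightarrow> \<not> QuadRes (int p) (nonres p)"
  unfolding nonres_def using ex_not_QuadRes by (rule someI_ex)

text \<open>The product over all \<open>p\<close> of the rings \<open>\<int>[\<surd>n]/p\<close>, where \<open>n = nonres p\<close>; for an odd prime \<open>p\<close> the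
  \<open>p\<close>-th factor is the field with \<open>p\<^sup>2\<close> elements, the pair \<open>(a, b)\<close> standing for \<open>a + b \<surd>n\<close>.\<close>
definition fq_rel :: "(nat \<Rightarrow> int \<times> int) \<Rightarrow> (nat \<Rightarrow> int \<times> int) \<Rightarrow> bool" where
  "fq_rel f g \<longleftrightarrow> (\<forall>p. [fst (f p) = fst (g p)] (mod int p) \<and> [snd (f p) = snd (g p)] (mod int p))"

lemma equivp_fq_rel: "equivp fq_rel"
  by (rule equivpI) (auto simp: reflp_def symp_def transp_def fq_rel_def intro: cong_sym cong_trans)

quotient_type fq = "nat \<Rightarrow> int \<times> int" / fq_rel
  by (rule equivp_fq_rel)

instantiation fq :: comm_ring
begin

lift_definition zero_fq :: fq is "\<lambda>_. (0, 0)" .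

lift_definition plus_fq :: "fq \<Rightarrow> fq \<Rightarrow> fq" is "\<lambda>f g p. (fst (f p) + fst (g p), snd (f p) + snd (g p))"
  by (auto simp: fq_rel_def intro!: cong_add)

lift_definition minus_fq :: "fq \<Rightarrow> fq \<Rightarrow> fq" is "\<lambda>f g p. (fst (f p) - fst (g p), snd (f p) - snd (g p))"
  by (auto simp: fq_rel_def intro!: cong_diff)

lift_definition uminus_fq :: "fq \<Rightarrow> fq" is "\<lambda>f p. (- fst (f p), - snd (f p))"
  by (auto simp: fq_rel_def cong_minus_minus_iff)

lift_definition times_fq :: "fq \<Rightarrow> fq \<Rightarrow> fq" is
  "\<lambda>f g p. (fst (f p) * fst (g p) + nonres p * (snd (f p) * snd (g p)),
            fst (f p) * snd (g p) + snd (f p) * fst (g p))"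
  by (auto simp: fq_rel_def intro!: cong_add cong_mult)

instance
  by (standard; transfer; simp add: fq_rel_def algebra_simps)

end

text \<open>An element of the \<open>p\<close>-th factor, zero in all others. The unit of this
  subring is \<open>emb p 1 0\<close>, which is why the fields carry a unit \<open>e\<close> of
  their own.\<close>

lift_definition emb :: "nat \<Rightarrow> int \<Rightarrow> int \<Rightarrow> fq" is "\<lambda>p a b i. if i = p then (a, b) else (0, 0)" .

lemma emb_diff: "emb p a b - emb p c d = emb p (a - c) (b - d)"
  and emb_mult: "emb p a b * emb p c d = emb p (a * c + nonres p * (b * d)) (a * d + b * c)"
  by (transfer; simp add: fq_rel_def)+

lemma emb_0: "0 = emb p 0 0"
  by transfer (simp add: fq_rel_def)

lemma emb_eq_iff: "emb p a b = emb p c d \<longleftrightarrow> [a = c] (mod int p) \<and> [b = d] (mod int p)"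
  by transfer (auto simp: fq_rel_def)

text \<open>The Legendre symbol of the norm down to the prime field. On the prime field itself the
  norm is a square, so the character is trivial there.\<close>

lift_definition fq_char :: "nat \<Rightarrow> fq \<Rightarrow> real" is
  "\<lambda>p f. of_int (Legendre (fst (f p) ^ 2 - nonres p * snd (f p) ^ 2) (int p))"
  unfolding fq_rel_def by (auto intro!: Legendre_cong cong_diff cong_mult cong_pow)

lemma fq_char_emb: "fq_char p (emb p a b) = of_int (Legendre (a ^ 2 - nonres p * b ^ 2) (int p))"
  by transfer simp

section \<open>The fields of order \<open>p\<^sup>2\<close>, their prime fields and norms\<close>

definition fld :: "nat \<Rightarrow> fq set" where "fld p = (\<lambda>(a, b). emb p a b) ` UNIV"
definition prime_fld :: "nat \<Rightarrow> fq set" where "prime_fld p = (\<lambda>a. emb p a 0) ` UNIV"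

lemma emb_fld [simp]: "emb p a b \<in> fld p" by (auto simp: fld_def)
lemma emb_prime_fld [simp]: "emb p a 0 \<in> prime_fld p" by (auto simp: prime_fld_def)

lemma fldE: "x \<in> fld p \<Longrightarrow> (\<And>a b. x = emb p a b \<Longrightarrow> P) \<Longrightarrow> P"
  by (auto simp: fld_def)
lemma prime_fldE: "x \<in> prime_fld p \<Longrightarrow> (\<And>a. x = emb p a 0 \<Longrightarrow> P) \<Longrightarrow> P"
  by (auto simp: prime_fld_def)

lemma card_prime_fld: assumes "p > 0" shows "card (prime_fld p) = p"
proof -
  have "prime_fld p = (\<lambda>a. emb p a 0) ` {0..<int p}"
  proof
    show "prime_fld p \<subseteq> (\<lambda>a. emb p a 0) ` {0..<int p}"
    proof
      fix x assume "x \<in> prime_fld p"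
      then obtain a where "x = emb p a 0" by (rule prime_fldE)
      then have "x = emb p (a mod int p) 0" by (simp add: emb_eq_iff)
      then show "x \<in> (\<lambda>a. emb p a 0) ` {0..<int p}" using assms by auto
    qed
  qed auto
  moreover have "inj_on (\<lambda>a. emb p a 0) {0..<int p}"
    by (auto simp: inj_on_def emb_eq_iff intro: cong_less_imp_eq_int)
  ultimately show ?thesis by (simp add: card_image)
qed

lemma card_fld: assumes "p > 0" shows "card (fld p) = p\<^sup>2"
proof -
  have "fld p = (\<lambda>(a, b). emb p a b) ` ({0..<int p} \<times> {0..<int p})"
  proof
    show "fld p \<subseteq> (\<lambda>(a, b). emb p a b) ` ({0..<int p} \<times> {0..<int p})"
    proof
      fix x assume "x \<in> fld p"
      then obtain a b where "x = emb p a b" by (rule fldE)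
      then have "x = emb p (a mod int p) (b mod int p)" by (simp add: emb_eq_iff)
      then show "x \<in> (\<lambda>(a, b). emb p a b) ` ({0..<int p} \<times> {0..<int p})" using assms by auto
    qed
  qed auto
  moreover have "inj_on (\<lambda>(a, b). emb p a b) ({0..<int p} \<times> {0..<int p})"
    by (auto simp: inj_on_def emb_eq_iff intro: cong_less_imp_eq_int)
  ultimately show ?thesis by (simp add: card_image card_cartesian_product power2_eq_square)
qed

lemma subgrp_fld: "p > 0 \<Longrightarrow> subgrp (fld p)"
  unfolding subgrp_def
  by (auto simp: emb_diff emb_0[of p] elim!: fldE intro: card_ge_0_finite simp: card_fld)

lemma subgrp_prime_fld: "p > 0 \<Longrightarrow> subgrp (prime_fld p)"
  unfolding subgrp_def
  by (auto simp: emb_diff emb_0[of p] elim!: prime_fldE intro: card_ge_0_finite simp: card_prime_fld)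

lemma ex_inverse_mod_prime:
  assumes "prime p" "\<not> int p dvd n" shows "\<exists>k. [n * k = 1] (mod int p)"
  using assms by (metis cong_solve_coprime_int coprime_commute prime_imp_coprime prime_nat_int_transfer)

lemma ex_inverse_prime_fld:
  assumes "prime p" "x \<in> prime_fld p" "x \<noteq> 0" shows "\<exists>y\<in>prime_fld p. x * y = emb p 1 0"
proof -
  obtain a where a: "x = emb p a 0" using assms(2) by (rule prime_fldE)
  then have "\<not> int p dvd a" using assms(3) by (simp add: emb_0[of p] emb_eq_iff cong_0_iff)
  then obtain k where "[a * k = 1] (mod int p)" using ex_inverse_mod_prime assms(1) by blast
  then have "x * emb p k 0 = emb p 1 0" by (simp add: a emb_mult emb_eq_iff)
  then show ?thesis by auto
qed

lemma field_set_prime_fld: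
  assumes "prime p" shows "field_set (prime_fld p) (emb p 1 0)"
proof
  have p: "p > 0" using assms prime_gt_0_nat by blast
  show "subgrp (prime_fld p)" using p by (rule subgrp_prime_fld)
  show "emb p 1 0 \<noteq> 0" using assms by (auto simp: emb_0[of p] emb_eq_iff cong_0_iff)
  show "\<exists>y\<in>prime_fld p. x * y = emb p 1 0" if "x \<in> prime_fld p" "x \<noteq> 0" for x
    using ex_inverse_prime_fld[OF assms that] .
qed (auto elim!: prime_fldE simp: emb_mult)

text \<open>If \<open>b\<close> were invertible modulo \<open>p\<close>, the square of
  \<open>a / b\<close> would be the chosen nonresidue. So \<open>p\<close> divides \<open>b\<close>,
  and then \<open>a\<close>.\<close>

lemma norm_eq_0:
  assumes "prime p" "p > 2" "int p dvd a ^ 2 - nonres p * b ^ 2"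
  shows "int p dvd a \<and> int p dvd b"
proof -
  have pp: "prime (int p)" using assms by simp
  have odd: "odd p" using assms prime_odd_nat by auto
  have b: "int p dvd b"
  proof (rule ccontr)
    assume "\<not> ?thesis"
    then obtain k where k: "[b * k = 1] (mod int p)" using ex_inverse_mod_prime assms(1) by blast
    have "[a ^ 2 = nonres p * b ^ 2] (mod int p)" using assms(3) by (simp add: cong_iff_dvd_diff)
    then have "[a ^ 2 * k ^ 2 = nonres p * b ^ 2 * k ^ 2] (mod int p)" by (rule cong_mult) simp
    moreover have "[nonres p * (b * k) ^ 2 = nonres p * 1 ^ 2] (mod int p)"
      by (intro cong_mult cong_pow k) simp
    ultimately have "[(a * k) ^ 2 = nonres p] (mod int p)"
      by (simp add: power_mult_distrib mult.assoc) (metis cong_trans)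
    then show False using nonres[OF odd assms(2)] by (auto simp: QuadRes_def)
  qed
  then have "int p dvd nonres p * b ^ 2" by (simp add: power2_eq_square)
  from dvd_add[OF assms(3) this] have "int p dvd a ^ 2" by simp
  then show ?thesis using b pp prime_dvd_power by blast
qed

text \<open>Suppose all norms are squares. The norm of the root of the nonresidue \<open>n\<close>
  is \<open>- n\<close>, so \<open>- n\<close> is a nonzero square and
  \<open>- n * b\<^sup>2 = 1\<close> for some \<open>b\<close>. Then \<open>y\<^sup>2 + 1\<close> is
  the norm \<open>y\<^sup>2 - n * b\<^sup>2\<close>, again a square, and induction makes every
  residue a square.\<close>

lemma ex_norm_nonresidue:
  assumes "prime p" "p > 2" shows "\<exists>a b. Legendre (a ^ 2 - nonres p * b ^ 2) (int p) = -1"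
proof (rule ccontr)
  assume no: "\<not> ?thesis"
  have odd: "odd p" using assms prime_odd_nat by auto
  note nr = nonres[OF odd assms(2)]
  have sq: "\<exists>y. [y ^ 2 = a ^ 2 - nonres p * b ^ 2] (mod int p)" for a b
  proof (cases "[a ^ 2 - nonres p * b ^ 2 = 0] (mod int p)")
    case True
    then have "[0 ^ 2 = a ^ 2 - nonres p * b ^ 2] (mod int p)" by (simp add: cong_sym_eq)
    then show ?thesis by blast
  next
    case False
    then show ?thesis using no unfolding Legendre_def QuadRes_def by (metis (no_types, lifting))
  qed
  obtain k where k: "[k ^ 2 = - nonres p] (mod int p)" using sq[of 0 1] by auto
  have "\<not> int p dvd k"
  proof
    assume "int p dvd k"
    then have "int p dvd k ^ 2" by (simp add: power2_eq_square)
    then have "[0 ^ 2 = nonres p] (mod int p)"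
      using k by (metis cong_dvd_iff cong_0_iff cong_sym dvd_minus_iff power_zero_numeral)
    then show False using nr unfolding QuadRes_def by blast
  qed
  then obtain b where b: "[k * b = 1] (mod int p)" using ex_inverse_mod_prime assms(1) by blast
  have "[k ^ 2 * b ^ 2 = - nonres p * b ^ 2] (mod int p)" using k by (rule cong_mult) simp
  moreover have "[(k * b) ^ 2 = 1 ^ 2] (mod int p)" using b by (rule cong_pow)
  ultimately have nb: "[- nonres p * b ^ 2 = 1] (mod int p)"
    by (simp add: power_mult_distrib) (metis cong_sym cong_trans)
  have all: "\<exists>y. [y ^ 2 = int n] (mod int p)" for n
  proof (induction n)
    case 0
    have "[0 ^ 2 = int 0] (mod int p)" by simp
    then show ?case by blast
  next
    case (Suc n)
    then obtain y where y: "[y ^ 2 = int n] (mod int p)" by blast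
    obtain z where z: "[z ^ 2 = y ^ 2 - nonres p * b ^ 2] (mod int p)" using sq by blast
    have "[y ^ 2 + (- nonres p * b ^ 2) = int n + 1] (mod int p)" using y nb by (rule cong_add)
    then have "[z ^ 2 = int (Suc n)] (mod int p)" using cong_trans[OF z] by (simp add: add.commute)
    then show ?case by blast
  qed
  obtain y where "[y ^ 2 = int (nat (nonres p mod int p))] (mod int p)" using all by blast
  moreover have "int (nat (nonres p mod int p)) = nonres p mod int p" using assms(2) by simp
  ultimately have "[y ^ 2 = nonres p] (mod int p)" by (simp add: cong_def)
  then show False using nr by (auto simp: QuadRes_def)
qed

lemma quadratic_field_set_fld:
  assumes "prime p" "p > 2"
  obtains d where "quadratic_field_set (fld p) (emb p 1 0) (prime_fld p) (fq_char p) p d"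
proof -
  have p: "p > 0" using assms by simp
  have odd: "odd p" using assms prime_odd_nat by auto
  obtain a0 b0 where d: "Legendre (a0 ^ 2 - nonres p * b0 ^ 2) (int p) = -1"
    using ex_norm_nonresidue[OF assms] by blast
  have "quadratic_field_set (fld p) (emb p 1 0) (prime_fld p) (fq_char p) p (emb p a0 b0)"
  proof
    show "subgrp (fld p)" using p by (rule subgrp_fld)
    show "emb p 1 0 \<noteq> 0" using assms by (auto simp: emb_0[of p] emb_eq_iff cong_0_iff)
    show "x * y \<in> fld p" if "x \<in> fld p" "y \<in> fld p" for x y
      using that by (auto elim!: fldE simp: emb_mult)
    show "emb p 1 0 * x = x" if "x \<in> fld p" for x
      using that by (auto elim!: fldE simp: emb_mult)
    show "\<exists>y\<in>fld p. x * y = emb p 1 0" if x: "x \<in> fld p" "x \<noteq> 0" for x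
    proof -
      obtain a b where ab: "x = emb p a b" using x(1) by (rule fldE)
      then have "\<not> (int p dvd a \<and> int p dvd b)" using x(2) by (auto simp: emb_0[of p] emb_eq_iff cong_0_iff)
      then have "\<not> int p dvd a ^ 2 - nonres p * b ^ 2" using norm_eq_0[OF assms] by blast
      then obtain k where k: "[(a ^ 2 - nonres p * b ^ 2) * k = 1] (mod int p)"
        using ex_inverse_mod_prime assms(1) by blast
      \<comment> \<open>The inverse is the conjugate divided by the norm.\<close>
      have "x * emb p (a * k) (- b * k) = emb p ((a ^ 2 - nonres p * b ^ 2) * k) 0"
        by (simp add: ab emb_mult power2_eq_square algebra_simps)
      also have "\<dots> = emb p 1 0" using k by (simp add: emb_eq_iff)
      finally show ?thesis by (intro bexI[of _ "emb p (a * k) (- b * k)"]) simp_all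
    qed
    show "subgrp (prime_fld p)" using p by (rule subgrp_prime_fld)
    show "prime_fld p \<subseteq> fld p" by (auto elim!: prime_fldE)
    show "x * y \<in> prime_fld p" if "x \<in> prime_fld p" "y \<in> prime_fld p" for x y
      using that by (auto elim!: prime_fldE simp: emb_mult)
    show "\<exists>y\<in>prime_fld p. x * y = emb p 1 0" if "x \<in> prime_fld p" "x \<noteq> 0" for x
      using ex_inverse_prime_fld[OF assms(1) that] .
    show "card (prime_fld p) = p" "card (fld p) = p\<^sup>2" using p by (simp_all add: card_fld card_prime_fld)
    show "odd p" by (rule odd)
    show "fq_char p 0 = 0" by (simp add: emb_0[of p] fq_char_emb Legendre_def)
    show "fq_char p x = 1 \<or> fq_char p x = -1" if x: "x \<in> fld p" "x \<noteq> 0" for x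
    proof -
      obtain a b where ab: "x = emb p a b" using x(1) by (rule fldE)
      then have "\<not> (int p dvd a \<and> int p dvd b)" using x(2) by (auto simp: emb_0[of p] emb_eq_iff cong_0_iff)
      then have "\<not> int p dvd a ^ 2 - nonres p * b ^ 2" using norm_eq_0[OF assms] by blast
      then show ?thesis by (simp add: ab fq_char_emb Legendre_def cong_0_iff)
    qed
    show "fq_char p (x * y) = fq_char p x * fq_char p y" if xy: "x \<in> fld p" "y \<in> fld p" for x y
    proof -
      obtain a b where ab: "x = emb p a b" using xy(1) by (rule fldE)
      obtain a' b' where ab': "y = emb p a' b'" using xy(2) by (rule fldE)
      \<comment> \<open>Multiplicativity of the norm.\<close>
      have "(a * a' + nonres p * (b * b'))\<^sup>2 - nonres p * (a * b' + b * a')\<^sup>2 =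
        (a\<^sup>2 - nonres p * b\<^sup>2) * (a'\<^sup>2 - nonres p * b'\<^sup>2)"
        by (simp add: power2_eq_square algebra_simps)
      then show ?thesis by (simp add: ab ab' emb_mult fq_char_emb Legendre_mult[OF assms])
    qed
    show "fq_char p f = 1" if f: "f \<in> prime_fld p" "f \<noteq> 0" for f
    proof -
      obtain a where a: "f = emb p a 0" using f(1) by (rule prime_fldE)
      then have "\<not> int p dvd a" using f(2) by (simp add: emb_0[of p] emb_eq_iff cong_0_iff)
      then have "\<not> int p dvd a ^ 2" using assms(1) prime_dvd_power[of "int p" a 2] by auto
      moreover have "QuadRes (int p) (a ^ 2)" unfolding QuadRes_def by (rule exI[of _ a]) simp
      ultimately show ?thesis by (simp add: a fq_char_emb Legendre_def cong_0_iff)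
    qed
    show "fq_char p (emb p a0 b0) = -1" using d by (simp add: fq_char_emb)
  qed simp_all
  then show thesis by (rule that)
qed

section \<open>The plane of order three, and McFarland difference sets\<close>

context field_set
begin

lemma card_K_pos [simp]: "card K > 0"
  using card_gt_0_iff[of K] subgrp_finite[OF K] eK by blast

lemma coord_zero [simp]: "coord p 0 = 0"
  by (cases p) simp_all

lemma sum_ind_lines:
  assumes "v \<in> K \<times> K"
  shows "(\<Sum>p\<in>points. supp_line (\<lambda>_. 1) p v) = (if v = 0 then real (card points) else 1)"
proof (cases "v = 0")
  case True
  have "supp_line (\<lambda>_. 1) p v = 1" if "p \<in> points" for p
    using that subgrp_zero[OF subgrp_line] True by (simp add: supp_line_def)
  then show ?thesis using True by simp
next
  case False
  then obtain c l where c: "c \<in> points" "l \<in> K" "l \<noteq> 0" "v = smul l (rep c)"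
    using nonzero_vector assms by metis
  then show ?thesis using False by (simp add: supp_line_smul_rep)
qed

text \<open>Each of the four lines gives a function equal to -1 on the line and 1 off it. Distinct
  ones convolve to the constant \<open>9 - 6 - 6 + 4 = 1\<close>, so negating the last makes every
  mixed relation \<open>1 - 1 = 0\<close>. The squares sum to 12 times the number of lines through
  \<open>v\<close>, minus 12: 36 at the origin and 0 elsewhere.\<close>

lemma turyn_group_plane_3:
  assumes "card K = 3" shows "turyn_group (K \<times> K) 3"
proof -
  have "card points = Suc (Suc (Suc (Suc 0)))" using assms by (simp add: card_points)
  then obtain a b c d where abcd: "points = {a, b, c, d}" "a \<noteq> b" "a \<noteq> c" "a \<noteq> d" "b \<noteq> c" "b \<noteq> d" "c \<noteq> d"
    unfolding card_Suc_eq by auto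
  have cp: "card points = 4" using assms by (simp add: card_points)
  define f where "f p = (\<lambda>v. 1 - 2 * supp_line (\<lambda>_. 1) p v)" for p
  have cV: "card (K \<times> K) = 3\<^sup>2" using assms by (simp add: card_cartesian_product)
  have one: "conv (K \<times> K) (supp_line (\<lambda>_. 1) p) (\<lambda>_. 1) v = 3" if "p \<in> points" for p v
  proof -
    have "conv (K \<times> K) (supp_line (\<lambda>_. 1) p) (\<lambda>_. 1) v = (\<Sum>w\<in>line p. 1)"
      unfolding conv_def using line_subset[of p] subgrp_finite[OF subgrp_plane]
      by (intro sum.mono_neutral_cong_right) (auto simp: supp_line_def)
    also have "\<dots> = 3"
      using that assms by (simp add: line_image card_image[OF inj_on_smul_rep])
    finally show ?thesis .
  qed
  have ff: "conv (K \<times> K) (f p) (f q) v = (if p = q then 12 * supp_line (\<lambda>_. 1) p v - 3 else 1)"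
    if "p \<in> points" "q \<in> points" "v \<in> K \<times> K" for p q v
  proof -
    have "conv (K \<times> K) (f p) (f q) v = 9 - 2 * 3 - 2 * 3 +
        4 * conv (K \<times> K) (supp_line (\<lambda>_. 1) p) (supp_line (\<lambda>_. 1) q) v"
      unfolding f_def conv_diff_left conv_diff_right conv_scale_left conv_scale_right
      using one[OF that(1)] one[OF that(2)] conv_commute[OF subgrp_plane that(3), of "\<lambda>_. 1" "supp_line (\<lambda>_. 1) q"]
        cV by (simp add: conv_def[of _ "\<lambda>_. 1" "\<lambda>_. 1"])
    moreover have "conv (K \<times> K) (supp_line (\<lambda>_. 1) p) (supp_line (\<lambda>_. 1) q) v =
        (if p = q then 3 * supp_line (\<lambda>_. 1) p v else 1)"
    proof (cases "p = q")
      case True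
      have "conv K (\<lambda>_. 1) (\<lambda>_. 1) (coord p v) = 3" by (simp add: conv_def assms)
      then show ?thesis using True that by (simp add: conv_supp_line_same supp_line_def)
    next
      case False
      then show ?thesis using that by (simp add: conv_supp_line_distinct)
    qed
    ultimately show ?thesis by simp
  qed
  have "even_sign (K \<times> K) (f p)" for p
    by (auto simp: even_sign_def f_def supp_line_minus) (auto simp: supp_line_def)
  then have sgn: "even_sign (K \<times> K) (f p)" "even_sign (K \<times> K) (\<lambda>v. - f p v)" for p
    by (auto simp: even_sign_def)
  have P: "a \<in> points" "b \<in> points" "c \<in> points" "d \<in> points" using abcd by auto
  have "conv (K \<times> K) (f a) (f a) v + conv (K \<times> K) (f b) (f b) v + conv (K \<times> K) (f c) (f c) v +
      conv (K \<times> K) (\<lambda>v. - f d v) (\<lambda>v. - f d v) v = (if v = 0 then 4 * real (3\<^sup>2) else 0) \<and>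
    conv (K \<times> K) (f a) (f b) v + conv (K \<times> K) (f c) (\<lambda>v. - f d v) v = 0 \<and>
    conv (K \<times> K) (f a) (f c) v + conv (K \<times> K) (f b) (\<lambda>v. - f d v) v = 0 \<and>
    conv (K \<times> K) (f a) (\<lambda>v. - f d v) v + conv (K \<times> K) (f b) (f c) v = 0" if v: "v \<in> K \<times> K" for v
  proof -
    have "supp_line (\<lambda>_. 1) a v + supp_line (\<lambda>_. 1) b v + supp_line (\<lambda>_. 1) c v + supp_line (\<lambda>_. 1) d v
        = (if v = 0 then 4 else 1)"
      using sum_ind_lines[OF v] abcd(2-) unfolding cp unfolding abcd(1)
      by (cases "v = 0") (simp_all add: add.assoc)
    then show ?thesis unfolding conv_minus_left conv_minus_right
      using P abcd v by (simp add: ff split del: if_split) (simp split: if_splits)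
  qed
  then show ?thesis unfolding turyn_group_def using sgn subgrp_plane cV by blast
qed

section \<open>Hyperplanes of three-dimensional space\<close>

definition dot :: "'a \<times> 'a \<times> 'a \<Rightarrow> 'a \<times> 'a \<times> 'a \<Rightarrow> 'a" where
  "dot n x = fst n * fst x + (fst (snd n) * fst (snd x) + snd (snd n) * snd (snd x))"

abbreviation space :: "('a \<times> 'a \<times> 'a) set" where "space \<equiv> K \<times> K \<times> K"

definition smul3 :: "'a \<Rightarrow> 'a \<times> 'a \<times> 'a \<Rightarrow> 'a \<times> 'a \<times> 'a" where
  "smul3 l x = (l * fst x, l * fst (snd x), l * snd (snd x))"

text \<open>One normal vector for each hyperplane: the first nonzero entry is scaled to
  \<open>e\<close>.\<close>

definition normals :: "('a \<times> 'a \<times> 'a) set" where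
  "normals = (\<lambda>(a, b). (e, a, b)) ` (K \<times> K) \<union> (\<lambda>a. (0, e, a)) ` K \<union> {(0, 0, e)}"

definition hyper :: "'a \<times> 'a \<times> 'a \<Rightarrow> ('a \<times> 'a \<times> 'a) set" where
  "hyper n = {x \<in> space. dot n x = 0}"

lemma subgrp_space: "subgrp space"
  by (intro subgrp_prod K)

lemma dot_in [simp]: "n \<in> space \<Longrightarrow> x \<in> space \<Longrightarrow> dot n x \<in> K"
  by (auto simp: dot_def)

lemma dot_add: "dot n (x + y) = dot n x + dot n y"
  and dot_diff: "dot n (x - y) = dot n x - dot n y"
  and dot_smul3: "dot n (smul3 l x) = l * dot n x"
  by (simp_all add: dot_def smul3_def algebra_simps)

lemma dot_zero [simp]: "dot n 0 = 0"
  by (simp add: dot_def)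

lemma smul3_in [simp]: "l \<in> K \<Longrightarrow> x \<in> space \<Longrightarrow> smul3 l x \<in> space"
  by (auto simp: smul3_def)

lemma subgrp_hyper: "subgrp (hyper n)"
proof -
  have "finite (hyper n)" "0 \<in> hyper n"
    using subgrp_finite[OF subgrp_space] subgrp_zero[OF subgrp_space] by (simp_all add: hyper_def)
  moreover have "x - y \<in> hyper n" if "x \<in> hyper n" "y \<in> hyper n" for x y
    using that subgrp_diff[OF subgrp_space, of x y] by (simp add: hyper_def dot_diff del: mem_Sigma_iff)
  ultimately show ?thesis by (simp add: subgrp_def)
qed

lemma smul3_hyper: "l \<in> K \<Longrightarrow> x \<in> hyper n \<Longrightarrow> smul3 l x \<in> hyper n"
  using smul3_in by (simp add: hyper_def dot_smul3 del: mem_Sigma_iff)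

lemma normals_space: "n \<in> normals \<Longrightarrow> n \<in> space"
  by (auto simp: normals_def)

text \<open>A linear form that does not vanish on the subspace \<open>A\<close> takes the value
  \<open>e\<close> at some \<open>z\<close> in \<open>A\<close>; translation by multiples of
  \<open>z\<close> shows that all its fibres have equal size.\<close>

lemma card_dot_fibre:
  assumes A: "subgrp A" "A \<subseteq> space" "\<And>l x. l \<in> K \<Longrightarrow> x \<in> A \<Longrightarrow> smul3 l x \<in> A"
    and n: "n \<in> space" and w: "w \<in> A" "dot n w \<noteq> 0" and c: "c \<in> K"
  shows "card {x \<in> A. dot n x = c} * card K = card A"
proof -
  define z where "z = smul3 (finv (dot n w)) w"
  have dw: "dot n w \<in> K" using n w A(2) by (intro dot_in) auto
  then have z: "z \<in> A" "dot n z = e"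
    unfolding z_def dot_smul3 using w A(3) by auto
  have fib: "card {x \<in> A. dot n x = k} = card {x \<in> A. dot n x = 0}" if k: "k \<in> K" for k
  proof (rule bij_betw_same_card[of "\<lambda>x. x - smul3 k z"],
      rule bij_betw_byWitness[of _ "\<lambda>x. x + smul3 k z"])
    have "smul3 k z \<in> A" "dot n (smul3 k z) = k" using z k A(3) by (simp_all add: dot_smul3)
    then show "(\<lambda>x. x - smul3 k z) ` {x \<in> A. dot n x = k} \<subseteq> {x \<in> A. dot n x = 0}"
      "(\<lambda>x. x + smul3 k z) ` {x \<in> A. dot n x = 0} \<subseteq> {x \<in> A. dot n x = k}"
      by (intro image_subsetI; simp add: dot_diff dot_add subgrp_diff[OF A(1)] subgrp_add[OF A(1)])+
  qed auto
  have im: "dot n ` A \<subseteq> K" using A(2) by (intro image_subsetI dot_in[OF n]) (rule subsetD)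
  have "card A = (\<Sum>k\<in>K. card {x \<in> A. dot n x = k})"
    unfolding card_eq_sum by (rule sum.group[OF subgrp_finite[OF A(1)] subgrp_finite[OF K] im, symmetric])
  also have "\<dots> = (\<Sum>k\<in>K. card {x \<in> A. dot n x = 0})" by (intro sum.cong refl fib)
  also have "\<dots> = card K * card {x \<in> A. dot n x = 0}" by simp
  finally show ?thesis using fib[OF c] by simp
qed

lemma ex_dot_nonzero:
  assumes "n \<in> normals" shows "\<exists>w\<in>space. dot n w \<noteq> 0"
proof -
  have "n \<in> space" using assms by (rule normals_space)
  consider "fst n = e" | "fst (snd n) = e" | "snd (snd n) = e" using assms by (auto simp: normals_def)
  then show ?thesis
  proof cases
    case 1 then show ?thesis by (intro bexI[of _ "(e, 0, 0)"]) (auto simp: dot_def)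
  next
    case 2 then show ?thesis by (intro bexI[of _ "(0, e, 0)"]) (auto simp: dot_def)
  next
    case 3 then show ?thesis by (intro bexI[of _ "(0, 0, e)"]) (auto simp: dot_def)
  qed
qed

lemma card_hyper:
  assumes "n \<in> normals" shows "card (hyper n) = (card K)\<^sup>2"
proof -
  obtain w where w: "w \<in> space" "dot n w \<noteq> 0" using ex_dot_nonzero assms by blast
  have "card (hyper n) * card K = card space" unfolding hyper_def
    by (rule card_dot_fibre[OF subgrp_space order_refl smul3_in normals_space[OF assms] w]) simp_all
  also have "\<dots> = (card K)\<^sup>2 * card K" by (simp add: card_cartesian_product power2_eq_square)
  finally show ?thesis unfolding mult_cancel2 using card_K_pos by linarith
qed

text \<open>A vector orthogonal to two spanning vectors of \<open>hyper n\<close> is a multiple of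
  \<open>n\<close>, and the normalisation leaves only \<open>n\<close> itself.\<close>

lemma normals_independent:
  assumes n: "n \<in> normals" and n': "n' \<in> normals" and ne: "n \<noteq> n'"
  shows "\<exists>w\<in>hyper n. dot n' w \<noteq> 0"
proof (rule ccontr)
  assume "\<not> ?thesis"
  then have all: "dot n' w = 0" if "w \<in> hyper n" for w using that by blast
  obtain x y z where xyz: "n' = (x, y, z)" "x \<in> K" "y \<in> K" "z \<in> K"
    using normals_space[OF n'] by auto
  have form: "x = e \<or> x = 0 \<and> y = e \<or> x = 0 \<and> y = 0 \<and> z = e"
    using n' by (auto simp: normals_def xyz)
  consider a b where "a \<in> K" "b \<in> K" "n = (e, a, b)" | a where "a \<in> K" "n = (0, e, a)" | "n = (0, 0, e)"
    using n by (auto simp: normals_def)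
  then show False
  proof cases
    case (1 a b)
    have "(- a, e, 0) \<in> hyper n" "(- b, 0, e) \<in> hyper n" using 1 by (auto simp: hyper_def dot_def)
    from all[OF this(1)] all[OF this(2)] have "y = x * a" "z = x * b"
      using xyz by (simp_all add: dot_def add.commute eq_neg_iff_add_eq_0[symmetric])
    then show False using form ne 1 xyz(1) e_nz by auto
  next
    case (2 a)
    have "(e, 0, 0) \<in> hyper n" "(0, - a, e) \<in> hyper n" using 2 by (auto simp: hyper_def dot_def)
    from all[OF this(1)] all[OF this(2)] have "x = 0" "z = y * a"
      using xyz by (simp_all add: dot_def add.commute eq_neg_iff_add_eq_0[symmetric])
    then show False using form ne 2 xyz(1) e_nz by auto
  next
    case 3
    have "(e, 0, 0) \<in> hyper n" "(0, e, 0) \<in> hyper n" using 3 by (auto simp: hyper_def dot_def)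
    from all[OF this(1)] all[OF this(2)] have "x = 0" "y = 0"
      using xyz by (simp_all add: dot_def)
    then show False using form ne 3 xyz(1) e_nz by auto
  qed
qed

text \<open>The intersection is a fibre of \<open>dot n'\<close> on \<open>hyper n\<close>, on which
  this form does not vanish, so it has a \<open>card K\<close>-th part of the points.\<close>

lemma card_hyper_coset:
  assumes "n \<in> normals" "n' \<in> normals" "n \<noteq> n'" "x \<in> space"
  shows "card {w \<in> hyper n. w - x \<in> hyper n'} = card K"
proof -
  have sub: "hyper n \<subseteq> space" by (auto simp: hyper_def)
  have "{w \<in> hyper n. w - x \<in> hyper n'} = {w \<in> hyper n. dot n' w = dot n' x}"
    using subgrp_diff[OF subgrp_space _ assms(4)]
    by (auto simp: hyper_def dot_diff simp del: mem_Sigma_iff)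
  moreover obtain w where w: "w \<in> hyper n" "dot n' w \<noteq> 0" using normals_independent assms by blast
  moreover have "card {w \<in> hyper n. dot n' w = dot n' x} * card K = card (hyper n)"
    by (rule card_dot_fibre[OF subgrp_hyper sub smul3_hyper normals_space[OF assms(2)] w])
       (simp_all add: normals_space assms del: mem_Sigma_iff)
  ultimately have "card {w \<in> hyper n. w - x \<in> hyper n'} * card K = card K * card K"
    by (simp add: card_hyper[OF assms(1)] power2_eq_square)
  then show ?thesis unfolding mult_cancel2 using card_K_pos by linarith
qed

lemma card_linear_solutions:
  assumes "c \<in> K" "x \<in> K" "x \<noteq> 0" shows "card {a \<in> K. c + a * x = 0} = 1"
proof -
  have "{a \<in> K. c + a * x = 0} = {- c * finv x}"
  proof (intro equalityI subsetI)
    fix a assume a: "a \<in> {a \<in> K. c + a * x = 0}"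
    then have "- c = a * x" by (simp add: minus_unique)
    then have "- c * finv x = a * (x * finv x)" by (simp add: mult.assoc)
    then show "a \<in> {- c * finv x}" using a assms by simp
  next
    fix a assume "a \<in> {- c * finv x}"
    then have a: "a = - c * finv x" by simp
    have "a * x = - c * (finv x * x)" unfolding a by (simp only: mult.assoc)
    then show "a \<in> {a \<in> K. c + a * x = 0}" using a assms by simp
  qed
  then show ?thesis by simp
qed

lemma card_normals_conj:
  "card {n \<in> normals. P n} = card {(a, b) \<in> K \<times> K. P (e, a, b)} + card {a \<in> K. P (0, e, a)}
    + (if P (0, 0, e) then 1 else 0)"
proof -
  let ?X = "{(a, b) \<in> K \<times> K. P (e, a, b)}" and ?Y = "{a \<in> K. P (0, e, a)}"
    and ?Z = "if P (0, 0, e) then {(0 :: 'a, 0 :: 'a, e)} else {}"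
  let ?f = "\<lambda>(a, b). (e, a, b)" and ?g = "\<lambda>a. (0 :: 'a, e, a)"
  have "{n \<in> normals. P n} = ?f ` ?X \<union> (?g ` ?Y \<union> ?Z)"
    by (auto simp: normals_def)
  moreover have "card (?f ` ?X \<union> (?g ` ?Y \<union> ?Z)) = card (?f ` ?X) + card (?g ` ?Y \<union> ?Z)"
  proof (rule card_Un_disjoint)
    show "finite (?f ` ?X)" using finite_subset[of ?X "K \<times> K"] by auto
  qed (use e_nz in auto)
  moreover have "card (?g ` ?Y \<union> ?Z) = card (?g ` ?Y) + card ?Z"
    by (rule card_Un_disjoint) (use e_nz in auto)
  moreover have "card (?f ` ?X) = card ?X" by (rule card_image) (auto simp: inj_on_def)
  moreover have "card (?g ` ?Y) = card ?Y" by (rule card_image) (auto simp: inj_on_def)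
  ultimately show ?thesis by simp
qed

lemma card_normals: "card normals = (card K)\<^sup>2 + card K + 1"
  using card_normals_conj[of "\<lambda>_. True"] by (simp add: card_cartesian_product power2_eq_square case_prod_unfold)
     (simp add: card_cartesian_product mem_Times_iff[symmetric])

text \<open>Each of the three normal forms gives a linear equation for the remaining entries of the
  normal. According to the last nonzero entry of \<open>x\<close>, the three forms contribute
  \<open>q, 1, 0\<close> or \<open>q, 0, 1\<close> or \<open>0, q, 1\<close> solutions, where
  \<open>q\<close> is the order of \<open>K\<close>.\<close>

lemma card_hyper_through:
  assumes x: "x \<in> space" "x \<noteq> 0"
  shows "card {n \<in> normals. x \<in> hyper n} = card K + 1"
proof -
  obtain x1 x2 x3 where x123: "x = (x1, x2, x3)" "x1 \<in> K" "x2 \<in> K" "x3 \<in> K" using x(1) by auto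
  have nz: "x1 \<noteq> 0 \<or> x2 \<noteq> 0 \<or> x3 \<noteq> 0" using x(2) by (auto simp: x123 zero_prod_def)
  have "card {n \<in> normals. x \<in> hyper n} = card {n \<in> normals. dot n x = 0}"
    using x(1) by (simp add: hyper_def)
  also have "\<dots> = card {(a, b) \<in> K \<times> K. x1 + (a * x2 + b * x3) = 0} + card {a \<in> K. x2 + a * x3 = 0}
    + (if x3 = 0 then 1 else 0)"
    unfolding card_normals_conj using x123 by (simp add: dot_def)
  also have "{(a, b) \<in> K \<times> K. x1 + (a * x2 + b * x3) = 0} = Sigma K (\<lambda>a. {b \<in> K. (x1 + a * x2) + b * x3 = 0})"
    by (auto simp: add.assoc)
  also have "card \<dots> = (\<Sum>a\<in>K. card {b \<in> K. (x1 + a * x2) + b * x3 = 0})"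
    by (simp add: card_SigmaI)
  finally have main: "card {n \<in> normals. x \<in> hyper n} = (\<Sum>a\<in>K. card {b \<in> K. (x1 + a * x2) + b * x3 = 0})
     + card {a \<in> K. x2 + a * x3 = 0} + (if x3 = 0 then 1 else 0)" .
  show ?thesis
  proof (cases "x3 = 0")
    case False
    then show ?thesis unfolding main using x123 by (simp add: card_linear_solutions)
  next
    case x3: True
    have "(\<Sum>a\<in>K. card {b \<in> K. (x1 + a * x2) + b * x3 = 0}) = (\<Sum>a\<in>K. if x1 + a * x2 = 0 then card K else 0)"
      unfolding x3 by (intro sum.cong refl) auto
    also have "\<dots> = card K * card {a \<in> K. x1 + a * x2 = 0}"
      by (simp flip: sum.inter_filter)
    finally have s: "(\<Sum>a\<in>K. card {b \<in> K. (x1 + a * x2) + b * x3 = 0}) = card K * card {a \<in> K. x1 + a * x2 = 0}" .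
    show ?thesis
    proof (cases "x2 = 0")
      case False
      then show ?thesis unfolding main s using x123 x3 by (simp add: card_linear_solutions)
    next
      case True
      then show ?thesis unfolding main s using nz x3 by simp
    qed
  qed
qed

text \<open>McFarland's difference set: the hyperplanes of \<open>K\<^sup>3\<close>, distributed over the nonzero elements of an
  elementary abelian 2-group of matching size. It equals its own negative because hyperplanes are subgroups
  and every element of the 2-group is its own inverse.\<close>
theorem triple_array_mcfarland:
  fixes U :: "'u::ab_group_add set"
  assumes U: "subgrp U" and inv: "\<And>k. k \<in> U \<Longrightarrow> - k = k" and cU: "card U = (card K)\<^sup>2 + card K + 2"
  defines "q \<equiv> card K"
  defines "v \<equiv> (q\<^sup>2 + q + 2) * q ^ 3" and "k \<equiv> (q\<^sup>2 + q + 1) * q\<^sup>2" and "l \<equiv> (q + 1) * q\<^sup>2"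
  shows "\<exists>(V :: nat set) A. triple_array (v - 1) (k - l) (v + l - 2 * k) l (k - l) k (v - k) V A"
proof -
  have fU: "finite U" using U by (rule subgrp_finite)
  \<comment> \<open>There are \<open>q\<^sup>2 + q + 1\<close> hyperplanes, as many as nonzero
    elements of \<open>U\<close>.\<close>
  have "card (U - {0}) = card normals" using fU subgrp_zero[OF U] cU by (simp add: card_normals)
  then obtain \<beta> where \<beta>: "bij_betw \<beta> (U - {0}) normals"
    using fU finite_same_card_bij[of "U - {0}" normals] by (auto simp: normals_def)
  have \<beta>n: "\<beta> j \<in> normals" if "j \<in> U" "j \<noteq> 0" for j using \<beta> that by (auto simp: bij_betw_def)
  have \<beta>i: "\<beta> i \<noteq> \<beta> j" if "i \<in> U - {0}" "j \<in> U - {0}" "i \<noteq> j" for i j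
    using \<beta> that by (auto simp: bij_betw_def inj_on_def)
  have fh: "finite (hyper n)" for n using subgrp_hyper subgrp_finite by blast
  define D where "D = Sigma (U - {0}) (\<lambda>j. hyper (\<beta> j))"
  have G: "subgrp (U \<times> space)" by (intro subgrp_prod U K)
  have cG: "card (U \<times> space) = v"
    by (simp add: card_cartesian_product cU v_def q_def power3_eq_cube mult.assoc)
  have DG: "D \<subseteq> U \<times> space" by (auto simp: D_def hyper_def)
  have cD: "card D = k"
    using fU fh subgrp_zero[OF U]
    by (simp add: D_def card_SigmaI card_hyper \<beta>n cU k_def q_def)
  have rev: "- y \<in> D" if "y \<in> D" for y
  proof -
    obtain j w where y: "y = (j, w)" "j \<in> U - {0}" "w \<in> hyper (\<beta> j)" using \<open>y \<in> D\<close> unfolding D_def by blast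
    then have "- y = (j, - w)" using inv by simp
    then show ?thesis using y(2) subgrp_minus[OF subgrp_hyper y(3)] by (simp add: D_def)
  qed
  have dif: "card {y \<in> D. y - g \<in> D} = l" if g: "g \<in> U \<times> space" "g \<noteq> 0" for g
  proof -
    obtain h x where hx: "g = (h, x)" "h \<in> U" "x \<in> space" using g(1) by blast
    \<comment> \<open>Both \<open>j\<close> and \<open>j - h\<close> must be nonzero, since no
      hyperplane sits over 0.\<close>
    have "{y \<in> D. y - g \<in> D} = Sigma (U - {0, h}) (\<lambda>j. {w \<in> hyper (\<beta> j). w - x \<in> hyper (\<beta> (j - h))})"
    proof (rule Set.set_eqI)
      fix y :: "'u \<times> 'a \<times> 'a \<times> 'a"
      obtain j w where y: "y = (j, w)" by (rule prod.exhaust)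
      show "y \<in> {y \<in> D. y - g \<in> D} \<longleftrightarrow>
          y \<in> Sigma (U - {0, h}) (\<lambda>j. {w \<in> hyper (\<beta> j). w - x \<in> hyper (\<beta> (j - h))})"
        using subgrp_diff[OF U _ hx(2), of j] by (auto simp: D_def hx(1) y)
    qed
    then have card: "card {y \<in> D. y - g \<in> D} =
        (\<Sum>j\<in>U - {0, h}. card {w \<in> hyper (\<beta> j). w - x \<in> hyper (\<beta> (j - h))})"
      using fU fh by (simp add: card_SigmaI)
    show ?thesis
    proof (cases "h = 0")
      \<comment> \<open>Each hyperplane is compared with its own translate by \<open>x\<close>: it
        contributes all its \<open>q\<^sup>2\<close> points if it contains \<open>x\<close> and none
        otherwise, and \<open>q + 1\<close> hyperplanes contain \<open>x\<close>.\<close>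
      case True
      then have "x \<noteq> 0" using g(2) by (simp add: hx(1) zero_prod_def)
      have "card {w \<in> hyper (\<beta> j). w - x \<in> hyper (\<beta> j)} = (if x \<in> hyper (\<beta> j) then q\<^sup>2 else 0)"
        if "j \<in> U - {0}" for j
      proof -
        have "w - x \<in> hyper (\<beta> j) \<longleftrightarrow> x \<in> hyper (\<beta> j)" if "w \<in> hyper (\<beta> j)" for w
          using subgrp_diff[OF subgrp_hyper that, of x] subgrp_diff[OF subgrp_hyper that, of "w - x"] by auto
        then have "{w \<in> hyper (\<beta> j). w - x \<in> hyper (\<beta> j)} = (if x \<in> hyper (\<beta> j) then hyper (\<beta> j) else {})"
          by auto
        then show ?thesis using \<beta>n that by (simp add: card_hyper q_def)
      qed
      then have "card {y \<in> D. y - g \<in> D} = (\<Sum>j\<in>U - {0}. if x \<in> hyper (\<beta> j) then q\<^sup>2 else 0)"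
        unfolding card by (simp add: True)
      also have "\<dots> = (\<Sum>n\<in>normals. if x \<in> hyper n then q\<^sup>2 else 0)"
        by (rule sum.reindex_bij_betw[OF \<beta>])
      also have "\<dots> = q\<^sup>2 * card {n \<in> normals. x \<in> hyper n}"
        by (subst sum.inter_filter[symmetric]) (simp_all add: normals_def)
      also have "\<dots> = l"
        using card_hyper_through[OF hx(3) \<open>x \<noteq> 0\<close>] by (simp add: l_def q_def)
      finally show ?thesis .
    next
      \<comment> \<open>Now two different hyperplanes meet, up to translation, in \<open>q\<close>
        points for each of the \<open>q\<^sup>2 + q\<close> remaining \<open>j\<close>, which gives
        the same total.\<close>
      case False
      have "card {w \<in> hyper (\<beta> j). w - x \<in> hyper (\<beta> (j - h))} = q" if j: "j \<in> U - {0, h}" for j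
      proof -
        have "j - h \<in> U" "j - h \<noteq> 0" "j - h \<noteq> j" using j False subgrp_diff[OF U _ hx(2)] by auto
        then show ?thesis unfolding q_def using j hx(3) by (intro card_hyper_coset \<beta>n \<beta>i) auto
      qed
      then have "card {y \<in> D. y - g \<in> D} = card (U - {0, h}) * q" unfolding card by simp
      also have "card (U - {0, h}) = q\<^sup>2 + q"
        using False hx(2) subgrp_zero[OF U] fU cU by (simp add: card_Diff_subset q_def)
      finally show ?thesis by (simp add: l_def power2_eq_square algebra_simps)
    qed
  qed
  show ?thesis by (rule triple_array_of_difference_set[OF G cG DG cD rev dif])
qed

end

section \<open>Assembling the groups\<close>

text \<open>All groups needed embed into this one, and so do products of its subgroups.\<close>
type_synonym univ_group = "nat \<Rightarrow> bit \<times> fq"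

section \<open>Embeddings of products into one group\<close>

definition interleave :: "univ_group \<times> univ_group \<Rightarrow> univ_group" where
  "interleave z n = (if even n then fst z (n div 2) else snd z (n div 2))"

lemma interleave_diff: "interleave (x - y) = interleave x - interleave y"
  by (rule ext) (simp add: interleave_def)

lemma inj_interleave: "inj interleave"
proof (rule injI)
  fix x y assume "interleave x = interleave y"
  then have *: "interleave x n = interleave y n" for n by simp
  have "fst x n = fst y n" "snd x n = snd y n" for n
    using *[of "2 * n"] *[of "2 * n + 1"] by (simp_all add: interleave_def)
  then show "x = y" by (auto simp: prod_eq_iff)
qed

definition of_plane :: "fq \<times> fq \<Rightarrow> univ_group" where
  "of_plane z n = (if n = 0 then (0, fst z) else if n = 1 then (0, snd z) else 0)"

lemma of_plane_diff: "of_plane (x - y) = of_plane x - of_plane y"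
  by (rule ext) (simp add: of_plane_def zero_prod_def)

lemma inj_of_plane: "inj of_plane"
proof (rule injI)
  fix x y assume "of_plane x = of_plane y"
  then have "of_plane x 0 = of_plane y 0" "of_plane x 1 = of_plane y 1" by simp_all
  then show "x = y" by (simp add: of_plane_def prod_eq_iff)
qed

definition of_bits :: "(bit \<times> bit) \<times> univ_group \<Rightarrow> univ_group" where
  "of_bits z n = (if n = 0 then (fst (fst z), 0) else if n = 1 then (snd (fst z), 0) else snd z (n - 2))"

lemma of_bits_diff: "of_bits (x - y) = of_bits x - of_bits y"
  by (rule ext) (simp add: of_bits_def)

lemma inj_of_bits: "inj of_bits"
proof (rule injI)
  fix x y assume "of_bits x = of_bits y"
  then have *: "of_bits x n = of_bits y n" for n by simp
  have "snd x n = snd y n" for n using *[of "n + 2"] by (simp add: of_bits_def)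
  moreover have "fst x = fst y" using *[of 0] *[of 1] by (simp add: of_bits_def prod_eq_iff)
  ultimately show "x = y" by (auto simp: prod_eq_iff)
qed

text \<open>Fixing the type makes the existence of a group a predicate on numbers, which can be
  multiplied up by induction.\<close>

definition turyn_number :: "nat \<Rightarrow> bool" where
  "turyn_number u \<longleftrightarrow> (\<exists>H :: univ_group set. turyn_group H u)"

definition hadamard_number :: "nat \<Rightarrow> bool" where
  "hadamard_number u \<longleftrightarrow> (\<exists>H :: univ_group set. hadamard_group H u)"

lemma turyn_number_1: "turyn_number 1"
proof -
  have "turyn_group {0 :: univ_group} 1"
    unfolding turyn_group_def even_sign_def subgrp_def conv_def
    \<comment> \<open>On the trivial group the relations hold for any four signs with product -1;
      the search finds such a choice.\<close>
    by (intro conjI exI[of _ "\<lambda>_. 1"] exI[of _ "\<lambda>_. -1"]) auto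
  then show ?thesis unfolding turyn_number_def by blast
qed

lemma turyn_number_mult: "turyn_number u \<Longrightarrow> turyn_number v \<Longrightarrow> turyn_number (u * v)"
  unfolding turyn_number_def
  using turyn_group_image[OF inj_on_subset[OF inj_interleave subset_UNIV] interleave_diff]
    turyn_group_prod by blast

lemma turyn_number_plane: "turyn_group (A :: (fq \<times> fq) set) u \<Longrightarrow> turyn_number u"
  unfolding turyn_number_def
  using turyn_group_image[OF inj_on_subset[OF inj_of_plane subset_UNIV] of_plane_diff] by blast

lemma turyn_number_3: "turyn_number 3"
proof -
  interpret field_set "prime_fld 3" "emb 3 1 0" by (rule field_set_prime_fld) simp
  show ?thesis using turyn_group_plane_3 turyn_number_plane by (simp add: card_prime_fld)
qed

lemma turyn_number_prime_square:
  assumes "prime p" "p > 2" shows "turyn_number (p\<^sup>2)"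
proof -
  obtain d where "quadratic_field_set (fld p) (emb p 1 0) (prime_fld p) (fq_char p) p d"
    using quadratic_field_set_fld[OF assms] by blast
  then have "turyn_group (fld p \<times> fld p) (card (fld p))"
    by (rule quadratic_field_set.turyn_group_plane)
  then show ?thesis using turyn_number_plane assms by (simp add: card_fld)
qed

lemma turyn_number_odd_square: "odd m \<Longrightarrow> turyn_number (m\<^sup>2)"
proof (induction m rule: less_induct)
  case (less m)
  show ?case
  proof (cases "m = 1")
    case True then show ?thesis using turyn_number_1 by simp
  next
    case False
    then obtain p where p: "prime p" "p dvd m" using prime_factor_nat by blast
    then obtain k where k: "m = p * k" by blast
    have odd: "odd p" "odd k" using less.prems k by auto
    then have "p > 2" using p(1) prime_ge_2_nat[of p] by (cases "p = 2") auto
    moreover have "k < m"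
      unfolding k using odd(2) prime_gt_1_nat[OF p(1)] mult_strict_right_mono[of 1 p k] odd_pos by simp
    ultimately show ?thesis
      using turyn_number_mult[OF turyn_number_prime_square[OF p(1)] less.IH[of k]] odd
      by (simp add: k power_mult_distrib)
  qed
qed

lemma hadamard_number_of_turyn_number: "turyn_number u \<Longrightarrow> hadamard_number u"
  unfolding turyn_number_def hadamard_number_def
  using hadamard_group_image[OF inj_on_subset[OF inj_of_bits subset_UNIV] of_bits_diff]
    hadamard_group_of_turyn_group by blast

lemma hadamard_number_mult: "hadamard_number u \<Longrightarrow> hadamard_number v \<Longrightarrow> hadamard_number (2 * u * v)"
  unfolding hadamard_number_def
  using hadamard_group_image[OF inj_on_subset[OF inj_interleave subset_UNIV] interleave_diff]
    hadamard_group_prod by blast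

text \<open>The factor 2 comes from the tensor product with a group for the number 1.\<close>

lemma hadamard_number_power_2: "hadamard_number u \<Longrightarrow> hadamard_number (2 ^ a * u)"
proof (induction a)
  case (Suc a)
  then show ?case
    using hadamard_number_mult[OF hadamard_number_of_turyn_number[OF turyn_number_1], of "2 ^ a * u"]
    by (simp add: mult.assoc)
qed simp

text \<open>Pulling all factors 2 out of \<open>u\<close> leaves an odd square, possibly times 3.
  This is a Turyn number, and the powers of 2 are restored by tensor products.\<close>

lemma hadamard_number_squarefree_part:
  assumes "u > 0" "squarefree_part u dvd 6" shows "hadamard_number u"
proof -
  obtain m where u: "u = squarefree_part u * m ^ 2"
    using squarefree_part_nat_iff[OF assms(1)] by blast
  then have "m > 0" using assms(1) by (cases m) auto
  define a where "a = multiplicity 2 m"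
  obtain k where k: "m = 2 ^ a * k" "odd k"
    unfolding a_def using multiplicity_decompose'[of m 2] \<open>m > 0\<close> by auto
  have H: "hadamard_number (2 ^ (b + 2 * a) * (3 ^ c * k ^ 2))" if "c \<le> 1" for b c
  proof -
    have "turyn_number (3 ^ c * k ^ 2)"
      using that turyn_number_odd_square[OF k(2)] turyn_number_mult[OF turyn_number_3]
      by (cases c) auto
    then show ?thesis by (intro hadamard_number_power_2 hadamard_number_of_turyn_number)
  qed
  have "x \<in> {1, 2, 3, 6}" if "x dvd 6" for x :: nat
  proof -
    have "x \<le> 6" using that by (rule dvd_imp_le) simp
    then have "x \<in> {0, 1, 2, 3, 4, 5, 6}" by auto
    then show ?thesis using that by (elim insertE emptyE) simp_all
  qed
  from this[OF assms(2)] have "squarefree_part u \<in> {1, 2, 3, 6}" .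
  then consider "squarefree_part u = 1" | "squarefree_part u = 2" | "squarefree_part u = 3"
    | "squarefree_part u = 6" by blast
  then have "\<exists>b c. squarefree_part u = 2 ^ b * 3 ^ c \<and> c \<le> (1 :: nat)"
  proof cases
    case 1 then show ?thesis by (intro exI[of _ 0]) simp
  next
    case 2 then show ?thesis by (intro exI[of _ 1] exI[of _ 0]) simp
  next
    case 3 then show ?thesis by (intro exI[of _ 0] exI[of _ 1]) simp
  next
    case 4 then show ?thesis by (intro exI[of _ 1]) simp
  qed
  then obtain b c where bc: "squarefree_part u = 2 ^ b * 3 ^ c" "c \<le> (1 :: nat)" by blast
  have m2: "m ^ 2 = 2 ^ (2 * a) * k ^ 2"
    unfolding k(1) by (simp only: power_mult_distrib power_mult[symmetric] mult.commute[of a])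
  note u
  also have "squarefree_part u * m ^ 2 = 2 ^ b * 3 ^ c * (2 ^ (2 * a) * k ^ 2)" by (simp only: bc(1) m2)
  also have "\<dots> = 2 ^ (b + 2 * a) * (3 ^ c * k ^ 2)" by (simp add: power_add)
  finally have "u = 2 ^ (b + 2 * a) * (3 ^ c * k ^ 2)" .
  then show ?thesis using H[OF bc(2), of b] by simp
qed

theorem theorem4p10:
  shows "(\<forall>u::nat. u > 0 \<longrightarrow> squarefree_part u dvd 6 \<longrightarrow>
           (\<exists>(V :: nat set) A. triple_array (4 * u^2 - 1) (u^2) (u^2 + u) (u^2 - u) (u^2)
                                 (2 * u^2 - u) (2 * u^2 + u) V A)) \<and>
         (\<exists>(V :: nat set) A. triple_array 3999 625 2600 150 625 775 3225 V A)"
proof (intro conjI allI impI)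
  fix u :: nat assume "u > 0" "squarefree_part u dvd 6"
  then obtain H :: "univ_group set" where "hadamard_group H u"
    using hadamard_number_squarefree_part unfolding hadamard_number_def by blast
  then show "\<exists>(V :: nat set) A. triple_array (4 * u^2 - 1) (u^2) (u^2 + u) (u^2 - u) (u^2)
                                 (2 * u^2 - u) (2 * u^2 + u) V A"
    using \<open>u > 0\<close> by (rule triple_array_of_hadamard_group)
next
  \<comment> \<open>For the field of order 5 the 2-group needs order \<open>25 + 5 + 2 = 32\<close>,
    a power of 2. The difference set then has \<open>v = 4000\<close>, \<open>k = 775\<close> and
    \<open>l = 150\<close>.\<close>
  interpret field_set "prime_fld 5" "emb 5 1 0" by (rule field_set_prime_fld) simp
  let ?U = "UNIV :: (bit \<times> bit \<times> bit \<times> bit \<times> bit) set"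
  have U: "?U = UNIV \<times> UNIV \<times> UNIV \<times> UNIV \<times> UNIV" by simp
  have card5: "card (prime_fld 5) = 5" by (simp add: card_prime_fld)
  have "subgrp (UNIV :: bit set)" by (simp add: subgrp_def UNIV_bit)
  then have "subgrp ?U" unfolding U by (intro subgrp_prod)
  moreover have "card ?U = (card (prime_fld 5))\<^sup>2 + card (prime_fld 5) + 2"
    unfolding U card_cartesian_product card5 by (simp add: UNIV_bit)
  moreover have "- k = k" for k :: "bit \<times> bit \<times> bit \<times> bit \<times> bit"
    by (simp add: prod_eq_iff)
  ultimately show "\<exists>(V :: nat set) A. triple_array 3999 625 2600 150 625 775 3225 V A"
    using triple_array_mcfarland[of ?U] by (simp add: card5)
qed

end
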